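(* Let $p=p_n$ be in the dense regime, i.e. $\sqrt{\log n/n}\ll p\ll1$. Let $\rho_0=1/3$, fix $\beta_0\in(\sqrt{25/27},1)$, and let $\eta>0$ satisfy $$2-\rho_0+\eta-\frac{2\beta_0^2}{1+(\rho_0+\eta)^2}<0 .$$ Then for any deterministic almost $(1,\eta n)$-stable graph alignment algorithm $\mathcal{A}$ and all sufficiently large $n$, $$\mathbb{P}\big[\mathcal{A}(G,\mathsf{G})\in\mathrm{S}_{\beta_0}(G,\mathsf{G})\big]\le 1-\frac1{n^2},$$ where the probability is over $(G,\mathsf{G})\sim\mathbf{G}(n,p)^{\otimes2}$.
   Context: $\mathbf{G}(n,p)$ is the law of the Erdős–Rényi graph on $n$ labelled vertices with edge density $p$; $(G,\mathsf{G})\sim\mathbf{G}(n,p)^{\otimes2}$ means $G,\mathsf{G}$ are independent. For graphs with $0/1$ adjacency entries $G_{i,j},\mathsf{G}_{i,j}$ and $\pi\in\mathrm{S}_n$, set $\mathrm{O}(\pi)=\sum_{1\le i<j\le n}G_{i,j}\mathsf{G}_{\pi(i),\pi(j)}$ and $\widetilde{\mathrm{O}}(\pi)=\mathrm{O}(\pi)-\binom n2p^2$. With $D_{n,p}=\sqrt{n^3p^2\log n}$, let $\mathrm{S}_\beta(G,\mathsf{G})=\{\pi\in\mathrm{S}_n:\widetilde{\mathrm{O}}(\pi)\ge\beta D_{n,p}\}$. Let $\mathfrak{G}_n$ be the set of simple graphs on $n$ labelled vertices. A deterministic graph alignment algorithm is (for each $n$) a function $\mathcal{A}:\mathfrak{G}_n\times\mathfrak{G}_n\to\mathrm{S}_n$.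 Let $\mathrm{d}(\pi,\pi')=\#\{i:\pi(i)\ne\pi'(i)\}$ be the Hamming distance on $\mathrm{S}_n$. The algorithm $\mathcal{A}$ is almost $(\Delta,\kappa)$-stable if, for $(G,\mathsf{G})\sim\mathbf{G}(n,p)^{\otimes2}$, with probability $1-o(1/n^2)$ one has $\mathrm{d}(\mathcal{A}(G,\mathsf{G}),\mathcal{A}(G',\mathsf{G}))\le\kappa$ for any graph $G'$ that differs from $G$ in at most $\Delta$ edges. $f\ll g$ means $f/g\to0$ as $n\to\infty$. *)

theory Defs
  imports "HOL-Probability.Probability" "HOL-Library.Ramsey" "HOL-Library.Landau_Symbols"
begin

text \<open>
  A simple graph on the vertex set \<open>{1..n}\<close> is identified with its edge set, a set of
  two-element subsets of \<open>{1..n}\<close>.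
\<close>

type_synonym graph = "nat set set"

definition simple_graphs :: "nat \<Rightarrow> graph set" where
  "simple_graphs n = Pow (nsets {1..n} 2)"

definition adj :: "graph \<Rightarrow> nat \<Rightarrow> nat \<Rightarrow> real" where
  "adj G i j = of_bool ({i, j} \<in> G)"

definition erdos_renyi :: "nat \<Rightarrow> real \<Rightarrow> graph pmf" where
  "erdos_renyi n p =
     map_pmf (\<lambda>f. {e \<in> nsets {1..n} 2. f e})
       (Pi_pmf (nsets {1..n} 2) False (\<lambda>_. bernoulli_pmf p))"

definition erdos_renyi_pair :: "nat \<Rightarrow> real \<Rightarrow> (graph \<times> graph) pmf" where
  "erdos_renyi_pair n p = pair_pmf (erdos_renyi n p) (erdos_renyi n p)"

definition overlap :: "nat \<Rightarrow> graph \<Rightarrow> graph \<Rightarrow> (nat \<Rightarrow> nat) \<Rightarrow> real" where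
  "overlap n G H \<pi> = (\<Sum>(i, j) | 1 \<le> i \<and> i < j \<and> j \<le> n. adj G i j * adj H (\<pi> i) (\<pi> j))"

definition centered_overlap :: "nat \<Rightarrow> real \<Rightarrow> graph \<Rightarrow> graph \<Rightarrow> (nat \<Rightarrow> nat) \<Rightarrow> real" where
  "centered_overlap n p G H \<pi> = overlap n G H \<pi> - real (n choose 2) * p\<^sup>2"

definition D_scale :: "nat \<Rightarrow> real \<Rightarrow> real" where
  "D_scale n p = sqrt (real n ^ 3 * p\<^sup>2 * ln (real n))"

definition S_set :: "real \<Rightarrow> nat \<Rightarrow> real \<Rightarrow> graph \<Rightarrow> graph \<Rightarrow> (nat \<Rightarrow> nat) set" where
  "S_set \<beta> n p G H =
     {\<pi>. \<pi> permutes {1..n} \<and> centered_overlap n p G H \<pi> \<ge> \<beta> * D_scale n p}"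

definition alignment_algorithm :: "(nat \<Rightarrow> graph \<Rightarrow> graph \<Rightarrow> nat \<Rightarrow> nat) \<Rightarrow> bool" where
  "alignment_algorithm \<A> \<longleftrightarrow>
     (\<forall>n. \<forall>G\<in>simple_graphs n. \<forall>H\<in>simple_graphs n. \<A> n G H permutes {1..n})"

definition hamming_dist :: "nat \<Rightarrow> (nat \<Rightarrow> nat) \<Rightarrow> (nat \<Rightarrow> nat) \<Rightarrow> nat" where
  "hamming_dist n \<pi> \<pi>' = card {i \<in> {1..n}. \<pi> i \<noteq> \<pi>' i}"

definition edge_dist :: "graph \<Rightarrow> graph \<Rightarrow> nat" where
  "edge_dist G G' = card ((G - G') \<union> (G' - G))"

text \<open>
  Both stability parameters may depend on \<open>n\<close>. Only the first graph is perturbed, and the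
  bound is required simultaneously for all perturbations \<open>G'\<close> inside the event.
\<close>

definition almost_stable ::
  "(nat \<Rightarrow> real) \<Rightarrow> (nat \<Rightarrow> real) \<Rightarrow> (nat \<Rightarrow> real) \<Rightarrow>
   (nat \<Rightarrow> graph \<Rightarrow> graph \<Rightarrow> nat \<Rightarrow> nat) \<Rightarrow> bool" where
  "almost_stable p \<Delta> \<kappa> \<A> \<longleftrightarrow>
     (\<lambda>n. 1 - measure_pmf.prob (erdos_renyi_pair n (p n))
            {(G, H). \<forall>G'\<in>simple_graphs n. real (edge_dist G G') \<le> \<Delta> n \<longrightarrow>
                real (hamming_dist n (\<A> n G H) (\<A> n G' H)) \<le> \<kappa> n})
       \<in> o(\<lambda>n. 1 / (real n)\<^sup>2)"

end

(*
  Resample the edges of the first graph one at a time, from G to an independent copy, keeping the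
  second graph H fixed. If the algorithm succeeded with probability above 1 - 1/n^2, then with
  probability bounded away from 0 it would succeed and be stable at all of the about n^2/2 steps.
  Its outputs start in full agreement with the first output and move by at most eta n per step, so
  some pair of near-optimal alignments agrees on between rho n and (rho + eta) n points, or on at
  least rho n points after complete resampling. Both are excluded by a first moment bound over pairs
  of permutations: there are at most n^((2 - rho + o(1)) n) pairs, and conditionally on H the two
  overlaps form a sum of independent variables, for which Chernoff's bound gives
  n^(-(2 beta^2 / (1 + x^2) - o(1)) n) when the agreement is x n. The conditional variance involves
  the number of pairs e, sigma(e) of edges of H, which must be controlled for all permutations
  sigma at once.
*)

theory Submission
  imports Defs "HOL-Real_Asymp.Real_Asymp"
begin

subsection \<open>Binomial random subsets\<close>

text \<open>The constants 1/3 and 25/27 come from one optimisation. At agreement rho n the first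
  moment has exponent 2 - rho - 2 beta^2 / (1 + rho^2) per n log n, which is negative iff beta^2 >
  (2 - rho)(1 + rho^2) / 2; on [0, 1] the right-hand side is least at rho = 1/3, with value 25/27.
  The window has width eta n, so its variance is taken at rho + eta, and the extra eta in the
  hypothesis is a margin n^(-eta n) that pays for all error terms. The rate 1/n^2 is matched to the
  path: it has n(n-1)/2 + 1 graphs, so their failures sum to at most 1/2. The density enters twice.
  The lower bound on p makes the Chernoff tilt, of order sqrt(log n / n) / p, tend to 0, so that a
  second-order expansion of exp gives the sharp constant; it also makes n^2 p outgrow the n log n
  paid for a union over all sigma. The upper bound p -> 0 makes the pairs e, sigma(e) with sigma(e)
  different from e, of density p^2, negligible against p n^2; only edges fixed by sigma, about half
  the squared number of fixed points, contribute to the covariance.\<close>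

lemma sum_indicator_card:
  fixes c :: real
  assumes "finite A" "P \<subseteq> A"
  shows "(\<Sum>e\<in>A. c * of_bool (e \<in> P)) = c * card P"
proof -
  have "(\<Sum>e\<in>A. c * of_bool (e \<in> P)) = (\<Sum>e\<in>A. if e \<in> P then c else 0)"
    by (intro sum.cong) auto
  also have "\<dots> = (\<Sum>e\<in>A \<inter> P. c)"
    using assms(1) by (simp only: sum.If_cases sum.neutral_const Collect_mem_eq add_0_right)
  finally show ?thesis using assms(2) by (simp add: Int_absorb1)
qed

text \<open>This is \<open>erdos_renyi\<close> with the edge slots replaced by an arbitrary ground
  set, so that moment bounds can be proved without mentioning graphs.\<close>

definition random_subset :: "'a set \<Rightarrow> real \<Rightarrow> 'a set pmf" where
  "random_subset A p = map_pmf (\<lambda>f. {e \<in> A. f e}) (Pi_pmf A False (\<lambda>_. bernoulli_pmf p))"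

lemma erdos_renyi_eq_random_subset: "erdos_renyi n p = random_subset (nsets {1..n} 2) p"
  by (simp add: erdos_renyi_def random_subset_def)

lemma set_pmf_random_subset: "set_pmf (random_subset A p) \<subseteq> Pow A"
  by (auto simp: random_subset_def)

lemma finite_set_pmf_random_subset: "finite A \<Longrightarrow> finite (set_pmf (random_subset A p))"
  using set_pmf_random_subset finite_subset by (metis finite_Pow_iff)

text \<open>Independence in the only form used later: exponential moments and containment indicators
  are both products over the ground set of functions of one membership bit.\<close>

lemma expectation_prod_random_subset:
  fixes g :: "'a \<Rightarrow> bool \<Rightarrow> real"
  assumes "finite A" "0 \<le> p" "p \<le> 1" "\<And>e b. 0 \<le> g e b"
  shows "measure_pmf.expectation (random_subset A p) (\<lambda>X. \<Prod>e\<in>A. g e (e \<in> X))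
    = (\<Prod>e\<in>A. p * g e True + (1 - p) * g e False)"
proof -
  have "measure_pmf.expectation (random_subset A p) (\<lambda>X. \<Prod>e\<in>A. g e (e \<in> X))
     = measure_pmf.expectation (Pi_pmf A False (\<lambda>_. bernoulli_pmf p)) (\<lambda>f. \<Prod>e\<in>A. g e (f e))"
    unfolding random_subset_def integral_map_pmf by simp
  also have "\<dots> = (\<Prod>e\<in>A. measure_pmf.expectation (bernoulli_pmf p) (g e))"
    by (rule expectation_prod_Pi_pmf) (auto intro!: integrable_measure_pmf_finite assms)
  finally show ?thesis using assms by (simp add: mult.commute)
qed

text \<open>The Poisson majorant 1 + y <= exp y of each Bernoulli factor makes the exponent additive
  over the ground set, so later bounds only have to count elements by weight.\<close>

lemma expectation_exp_random_subset_le: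
  fixes w :: "'a \<Rightarrow> real"
  assumes "finite A" "0 \<le> p" "p \<le> 1"
  shows "measure_pmf.expectation (random_subset A p) (\<lambda>X. exp (\<Sum>e\<in>A. w e * of_bool (e \<in> X)))
    \<le> exp (p * (\<Sum>e\<in>A. exp (w e) - 1))"
proof -
  have "measure_pmf.expectation (random_subset A p) (\<lambda>X. exp (\<Sum>e\<in>A. w e * of_bool (e \<in> X)))
     = (\<Prod>e\<in>A. p * exp (w e) + (1 - p))"
    using expectation_prod_random_subset[OF assms, of "\<lambda>e b. exp (w e * of_bool b)"] assms(1)
    by (simp only: exp_sum) simp
  also have "\<dots> \<le> (\<Prod>e\<in>A. exp (p * (exp (w e) - 1)))"
  proof (rule prod_mono)
    fix e
    have "p * exp (w e) + (1 - p) = 1 + p * (exp (w e) - 1)" by (simp add: algebra_simps)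
    also have "\<dots> \<le> exp (p * (exp (w e) - 1))" by (rule exp_ge_add_one_self)
    finally show "0 \<le> p * exp (w e) + (1 - p) \<and> p * exp (w e) + (1 - p) \<le> exp (p * (exp (w e) - 1))"
      using assms(2,3) by (intro conjI add_nonneg_nonneg mult_nonneg_nonneg) auto
  qed
  finally show ?thesis using assms(1) by (simp add: exp_sum sum_distrib_left)
qed

lemma prob_subset_random_subset:
  assumes "finite A" "0 \<le> p" "p \<le> 1" "F \<subseteq> A"
  shows "measure_pmf.prob (random_subset A p) {X. F \<subseteq> X} = p ^ card F"
proof -
  have F: "finite F" using assms finite_subset by blast
  have "measure_pmf.prob (random_subset A p) {X. F \<subseteq> X}
      = measure_pmf.expectation (random_subset A p) (indicator {X. F \<subseteq> X})"
    by simp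
  also have "\<dots> = measure_pmf.expectation (random_subset A p)
      (\<lambda>X. \<Prod>e\<in>A. (\<lambda>e b. of_bool (e \<in> F \<longrightarrow> b)) e (e \<in> X))"
  proof (intro Bochner_Integration.integral_cong refl)
    fix X
    have "(\<Prod>e\<in>A. of_bool (e \<in> F \<longrightarrow> e \<in> X) :: real) = of_bool (\<forall>e\<in>A. e \<in> F \<longrightarrow> e \<in> X)"
      using assms(1) by (induction A rule: finite_induct) auto
    then show "indicator {X. F \<subseteq> X} X = (\<Prod>e\<in>A. (\<lambda>e b. of_bool (e \<in> F \<longrightarrow> b)) e (e \<in> X) :: real)"
      using assms(4) by (auto simp: indicator_def)
  qed
  also have "\<dots> = (\<Prod>e\<in>A. if e \<in> F then p else 1)"
    by (subst expectation_prod_random_subset[OF assms(1-3)]) (auto intro!: prod.cong)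
  also have "\<dots> = p ^ card F"
    using assms(1,4) by (simp add: prod.If_cases Int_absorb1)
  finally show ?thesis .
qed

lemma map_pmf_pair_map_pmf:
  "map_pmf h (pair_pmf (map_pmf f M) (map_pmf g N)) = map_pmf (\<lambda>(x, y). h (f x, g y)) (pair_pmf M N)"
  by (simp add: pair_map_pmf1 pair_map_pmf2 map_pmf_comp case_prod_unfold)

text \<open>Membership bits are independent and identically distributed, so it does not matter from
  which of two independent copies each bit is read, as long as the choice \<open>E\<close> is
  deterministic.\<close>

lemma random_subset_resample:
  assumes "finite A"
  shows "map_pmf (\<lambda>(X, Y). (X - E) \<union> (Y \<inter> E)) (pair_pmf (random_subset A p) (random_subset A p))
    = random_subset A p"
proof -
  let ?P = "\<lambda>A. Pi_pmf A False (\<lambda>_. bernoulli_pmf p)"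
  have "random_subset A p = map_pmf (\<lambda>f. {e \<in> A. f e}) (?P ((A - E) \<union> (A \<inter> E)))"
    unfolding random_subset_def by (simp add: Un_Diff_Int)
  \<comment> \<open>\<open>Pi_pmf_union\<close> splits the law into independent halves;
    \<open>Pi_pmf_subset\<close> then writes each half as the restriction of a sample on all of
    \<open>A\<close>, which is what makes X and Y full random subsets.\<close>
  also have "\<dots> = map_pmf (\<lambda>f. {e \<in> A. f e}) (map_pmf (\<lambda>(f,g) x. if x \<in> A - E then f x else g x)
       (pair_pmf (map_pmf (\<lambda>f x. if x \<in> A - E then f x else False) (?P A))
                 (map_pmf (\<lambda>f x. if x \<in> A \<inter> E then f x else False) (?P A))))"
    using assms by (subst Pi_pmf_union)
      (auto simp only: Pi_pmf_subset[OF assms Diff_subset] Pi_pmf_subset[OF assms Int_lower1] finite_Diff finite_Int)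
  also have "\<dots> = map_pmf (\<lambda>(X, Y). (X - E) \<union> (Y \<inter> E)) (pair_pmf (random_subset A p) (random_subset A p))"
    unfolding random_subset_def map_pmf_pair_map_pmf map_pmf_comp
    by (intro map_pmf_cong refl) auto
  finally show ?thesis ..
qed

section \<open>Tail bounds for one random subset\<close>

text \<open>Exponential Markov inequality with the tilt \<open>l\<close> left free. The crude exp l
  - 1 - l <= l^2 suffices because this bound only serves to show that atypical hosts are rare, where
  constants do not matter.\<close>

lemma prob_random_subset_chernoff:
  assumes "finite A" "0 \<le> p" "p \<le> 1" "F \<subseteq> A" "0 \<le> l" "l \<le> 1"
  shows "measure_pmf.prob (random_subset A p) {X. real (card (X \<inter> F)) \<ge> p * card F + t}
     \<le> exp (p * card F * l\<^sup>2 - l * t)"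
proof -
  define M where "M = random_subset A p"
  have F: "finite F" using assms finite_subset by blast
  have fin: "finite (set_pmf M)" unfolding M_def using assms(1) by (rule finite_set_pmf_random_subset)
  have eq: "(\<Sum>e\<in>A. (l * of_bool (e \<in> F)) * of_bool (e \<in> X)) = l * card (X \<inter> F)" for X
  proof -
    have "(\<Sum>e\<in>A. (l * of_bool (e \<in> F)) * of_bool (e \<in> X)) = (\<Sum>e\<in>A. l * of_bool (e \<in> X \<inter> F))"
      by (intro sum.cong) auto
    also have "\<dots> = l * card (X \<inter> F)"
      using assms(4) by (intro sum_indicator_card assms(1)) auto
    finally show ?thesis .
  qed
  have "measure_pmf.prob M {X. real (card (X \<inter> F)) \<ge> p * card F + t}
     \<le> measure_pmf.prob M {X\<in>space M. exp (l * card (X \<inter> F)) \<ge> exp (l * (p * card F + t))}"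
    by (intro measure_pmf.finite_measure_mono) (auto intro!: mult_left_mono assms)
  also have "\<dots> \<le> measure_pmf.expectation M (\<lambda>X. exp (l * card (X \<inter> F))) / exp (l * (p * card F + t))"
    by (rule integral_Markov_inequality_measure[where A="{}"])
       (auto intro!: integrable_measure_pmf_finite fin)
  also have "measure_pmf.expectation M (\<lambda>X. exp (l * card (X \<inter> F)))
      \<le> exp (p * (\<Sum>e\<in>A. exp (l * of_bool (e \<in> F)) - 1))"
    using expectation_exp_random_subset_le[OF assms(1-3), of "\<lambda>e. l * of_bool (e \<in> F)"]
    unfolding eq M_def .
  also have "(\<Sum>e\<in>A. exp (l * of_bool (e \<in> F)) - 1) = (\<Sum>e\<in>A. if e \<in> F then exp l - 1 else 0)"
    by (intro sum.cong) auto
  also have "\<dots> = card F * (exp l - 1)"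
    using assms(1,4) by (simp add: sum.If_cases Int_absorb1)
  also have "exp (p * (card F * (exp l - 1))) / exp (l * (p * card F + t))
     = exp (p * card F * (exp l - 1 - l) - l * t)"
    by (simp add: exp_diff[symmetric] algebra_simps)
  also have "\<dots> \<le> exp (p * card F * l\<^sup>2 - l * t)"
  proof -
    have "exp l - 1 - l \<le> l\<^sup>2" using exp_bound[OF assms(5,6)] by simp
    then have "p * card F * (exp l - 1 - l) \<le> p * card F * l\<^sup>2"
      using assms(2) by (intro mult_left_mono) auto
    then show ?thesis by simp
  qed
  finally show ?thesis unfolding M_def by (simp add: divide_right_mono)
qed

text \<open>Take \<open>S\<close> maximal. An element that cannot be added lies in \<open>S\<close>,
  in the image of \<open>S\<close> or in its preimage, and injectivity bounds each of the three by
  \<open>card S\<close>. Equivalently, the graph joining x to f x has maximum degree 2, hence an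
  independent set of a third of its vertices.\<close>

lemma exists_independent_subset:
  assumes "finite F" "inj_on f F" "\<And>x. x \<in> F \<Longrightarrow> f x \<noteq> x"
  shows "\<exists>S\<subseteq>F. S \<inter> f ` S = {} \<and> card F \<le> 3 * card S"
proof -
  let ?P = "\<lambda>S. S \<subseteq> F \<and> S \<inter> f ` S = {}"
  let ?C = "{S. S \<subseteq> F \<and> S \<inter> f ` S = {}}"
  have "finite ?C" by (rule finite_subset[of _ "Pow F"]) (use assms(1) in auto)
  moreover have "{} \<in> ?C" by simp
  ultimately have "\<exists>S\<in>?C. \<forall>T\<in>?C. S \<subseteq> T \<longrightarrow> S = T"
    by (intro finite_has_maximal) auto
  then obtain S where S': "S \<in> ?C" and max': "\<forall>T\<in>?C. S \<subseteq> T \<longrightarrow> S = T" ..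
  have S: "?P S" using S' by simp
  have max: "S = T" if "?P T" "S \<subseteq> T" for T using max' that by simp
  have fS: "finite S" using S assms(1) finite_subset by blast
  have "F \<subseteq> S \<union> f ` S \<union> {x\<in>F. f x \<in> S}"
  proof
    fix x assume x: "x \<in> F"
    show "x \<in> S \<union> f ` S \<union> {x\<in>F. f x \<in> S}"
    proof (rule ccontr)
      assume *: "x \<notin> S \<union> f ` S \<union> {x\<in>F. f x \<in> S}"
      then have "?P (insert x S)" using S x assms(3)[OF x] by auto
      then have "S = insert x S" using max by blast
      then show False using * by auto
    qed
  qed
  then have "card F \<le> card (S \<union> f ` S \<union> {x\<in>F. f x \<in> S})"
    by (rule card_mono[rotated]) (use fS assms(1) in auto)
  also have "\<dots> \<le> card S + card (f ` S) + card {x\<in>F. f x \<in> S}"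
    using card_Un_le[of "S \<union> f ` S" "{x\<in>F. f x \<in> S}"] card_Un_le[of S "f ` S"] by linarith
  also have "card (f ` S) \<le> card S" by (rule card_image_le[OF fS])
  also have "card {x\<in>F. f x \<in> S} \<le> card S"
    by (rule card_inj_on_le[of f]) (use assms(2) fS in \<open>auto intro: inj_on_subset\<close>)
  finally show ?thesis using S by (intro exI[of _ S]) auto
qed

text \<open>
  The patterns \<open>x, f x\<close> are not independent. Passing to a third of them that are pairwise
  disjoint restores independence at the cost of a union bound over subsets, which is summed with
  exponential weight \<open>exp K\<close> per pattern.
\<close>

lemma prob_random_subset_displaced:
  assumes "finite A" "0 \<le> p" "p \<le> 1" "f ` A \<subseteq> A" "inj_on f A" "0 \<le> K"
  shows "measure_pmf.prob (random_subset A p)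
      {X. real (card {x\<in>A. x \<in> X \<and> f x \<in> X \<and> f x \<noteq> x}) \<ge> 3 * s}
     \<le> exp (exp K * p\<^sup>2 * card A - K * s)"
proof -
  define M where "M = random_subset A p"
  define \<S> where "\<S> = {S. S \<subseteq> A \<and> S \<inter> f ` S = {}}"
  have fin\<S>: "finite \<S>" unfolding \<S>_def using assms(1) by simp
  have "measure_pmf.prob M {X. real (card {x\<in>A. x \<in> X \<and> f x \<in> X \<and> f x \<noteq> x}) \<ge> 3 * s}
     \<le> measure_pmf.prob M (\<Union>S\<in>{S\<in>\<S>. real (card S) \<ge> s}. {X. S \<union> f ` S \<subseteq> X})"
  proof (rule measure_pmf.finite_measure_mono)
    show "{X. real (card {x\<in>A. x \<in> X \<and> f x \<in> X \<and> f x \<noteq> x}) \<ge> 3 * s}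
      \<subseteq> (\<Union>S\<in>{S\<in>\<S>. real (card S) \<ge> s}. {X. S \<union> f ` S \<subseteq> X})"
    proof
      fix X assume X: "X \<in> {X. real (card {x\<in>A. x \<in> X \<and> f x \<in> X \<and> f x \<noteq> x}) \<ge> 3 * s}"
      let ?F = "{x\<in>A. x \<in> X \<and> f x \<in> X \<and> f x \<noteq> x}"
      obtain S where S: "S \<subseteq> ?F" "S \<inter> f ` S = {}" "card ?F \<le> 3 * card S"
        using exists_independent_subset[of ?F f] finite_subset[of ?F A] inj_on_subset[of f A ?F] assms(1,5)
        by blast
      have "s \<le> card S" using S(3) X by simp
      then show "X \<in> (\<Union>S\<in>{S\<in>\<S>. real (card S) \<ge> s}. {X. S \<union> f ` S \<subseteq> X})"
        using S by (auto simp: \<S>_def)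
    qed
  qed auto
  also have "\<dots> \<le> (\<Sum>S\<in>{S\<in>\<S>. real (card S) \<ge> s}. measure_pmf.prob M {X. S \<union> f ` S \<subseteq> X})"
    using fin\<S> by (intro measure_pmf.finite_measure_subadditive_finite) auto
  also have "\<dots> \<le> (\<Sum>S\<in>{S\<in>\<S>. real (card S) \<ge> s}. exp (- K * s) * (exp K * p\<^sup>2) ^ card S)"
  proof (rule sum_mono)
    fix S assume "S \<in> {S\<in>\<S>. real (card S) \<ge> s}"
    then have S: "S \<subseteq> A" "S \<inter> f ` S = {}" "s \<le> card S" by (auto simp: \<S>_def)
    have fS: "finite S" using S(1) assms(1) finite_subset by blast
    have "card (S \<union> f ` S) = card S + card (f ` S)" using S fS by (simp add: card_Un_disjoint)
    also have "card (f ` S) = card S" by (rule card_image) (rule inj_on_subset[OF assms(5) S(1)])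
    finally have "card (S \<union> f ` S) = 2 * card S" by simp
    then have "measure_pmf.prob M {X. S \<union> f ` S \<subseteq> X} = (p\<^sup>2) ^ card S"
      unfolding M_def using S(1) assms by (subst prob_subset_random_subset) (auto simp: power_mult)
    also have "\<dots> \<le> exp (K * (card S - s)) * (p\<^sup>2) ^ card S"
    proof -
      have "1 \<le> exp (K * (card S - s))" using S(3) assms(6) by simp
      then show ?thesis using mult_right_mono[of 1 _ "(p\<^sup>2) ^ card S"] by simp
    qed
    also have "\<dots> = exp (- K * s) * (exp K * p\<^sup>2) ^ card S"
    proof -
      have "exp (K * (card S - s)) = exp (- K * s) * exp K ^ card S"
        by (simp add: algebra_simps flip: exp_of_nat_mult exp_add)
      then show ?thesis by (simp add: power_mult_distrib)
    qed
    finally show "measure_pmf.prob M {X. S \<union> f ` S \<subseteq> X} \<le> exp (- K * s) * (exp K * p\<^sup>2) ^ card S" .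
  qed
  also have "\<dots> \<le> (\<Sum>S\<in>Pow A. exp (- K * s) * (exp K * p\<^sup>2) ^ card S)"
    using assms(1) by (intro sum_mono2) (auto simp: \<S>_def)
  also have "\<dots> = exp (- K * s) * (1 + exp K * p\<^sup>2) ^ card A"
    using prod_add[OF assms(1), of "\<lambda>_. exp K * p\<^sup>2" "\<lambda>_. 1"]
    by (simp add: sum_distrib_left add.commute)
  also have "\<dots> \<le> exp (- K * s) * exp (exp K * p\<^sup>2) ^ card A"
    using assms by (intro mult_left_mono power_mono) (auto simp: exp_ge_add_one_self)
  also have "\<dots> = exp (exp K * p\<^sup>2 * card A - K * s)"
    by (simp add: exp_of_nat_mult[symmetric] exp_add[symmetric] algebra_simps)
  finally show ?thesis unfolding M_def .
qed

section \<open>Product laws and two partially resampled copies\<close>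

lemma expectation_pair_pmf_mult:
  fixes f :: "'a \<Rightarrow> real" and g :: "'b \<Rightarrow> real"
  assumes "finite (set_pmf M)" "finite (set_pmf N)"
  shows "measure_pmf.expectation (pair_pmf M N) (\<lambda>z. f (fst z) * g (snd z))
    = measure_pmf.expectation M f * measure_pmf.expectation N g"
proof -
  have "measure_pmf.expectation (pair_pmf M N) (\<lambda>z. f (fst z) * g (snd z))
    = (\<Sum>z\<in>set_pmf M \<times> set_pmf N. f (fst z) * g (snd z) * pmf (pair_pmf M N) z)"
    using assms by (intro integral_measure_pmf_real) auto
  also have "\<dots> = (\<Sum>x\<in>set_pmf M. \<Sum>y\<in>set_pmf N. (f x * pmf M x) * (g y * pmf N y))"
    by (simp add: sum.cartesian_product case_prod_unfold pmf_pair[of M N "fst z" "snd z" for z, simplified] mult_ac)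
  also have "\<dots> = (\<Sum>x\<in>set_pmf M. f x * pmf M x) * (\<Sum>y\<in>set_pmf N. g y * pmf N y)"
    by (simp add: sum_product)
  also have "\<dots> = measure_pmf.expectation M f * measure_pmf.expectation N g"
    using assms by (simp add: integral_measure_pmf_real[of "set_pmf M" M f] integral_measure_pmf_real[of "set_pmf N" N g])
  finally show ?thesis .
qed

text \<open>Conditioning on the first coordinate: sections over points outside \<open>R\<close> are
  empty, so a bound uniform over \<open>R\<close> is enough. Later the first coordinate is the host
  graph and \<open>R\<close> is typicality.\<close>

lemma prob_pair_pmf_le:
  assumes "\<And>x. x \<in> set_pmf M \<Longrightarrow> x \<in> R \<Longrightarrow> measure_pmf.prob N {y. (x, y) \<in> S} \<le> c" "0 \<le> c"
  shows "measure_pmf.prob (pair_pmf M N) {(x, y). x \<in> R \<and> (x, y) \<in> S} \<le> c"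
proof -
  let ?S = "{(x, y). x \<in> R \<and> (x, y) \<in> S}"
  have *: "pair_pmf M N = bind_pmf M (\<lambda>x. map_pmf (Pair x) N)"
    by (simp add: pair_pmf_def map_pmf_def)
  have "emeasure (pair_pmf M N) ?S = (\<integral>\<^sup>+x. emeasure N (Pair x -` ?S) \<partial>M)"
    by (simp add: *)
  also have "\<dots> \<le> (\<integral>\<^sup>+x. ennreal c \<partial>M)"
  proof (rule nn_integral_mono_AE, unfold AE_measure_pmf_iff, rule ballI)
    fix x assume x: "x \<in> set_pmf M"
    show "emeasure N (Pair x -` ?S) \<le> ennreal c"
    proof (cases "x \<in> R")
      case True
      then have "Pair x -` ?S = {y. (x, y) \<in> S}" by auto
      then show ?thesis using assms(1)[OF x True]
        by (simp add: measure_pmf.emeasure_eq_measure ennreal_leI)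
    next
      case False
      then have "Pair x -` ?S = {}" by auto
      then show ?thesis by (simp only: emeasure_empty zero_le)
    qed
  qed
  also have "\<dots> = ennreal c" by simp
  finally show ?thesis using assms(2) by (simp add: measure_pmf.emeasure_eq_measure)
qed

text \<open>As \<open>E\<close> grows from the empty set to the ground set this moves from X to Y;
  the randomness still shared with X sits on the positions outside \<open>E\<close>.\<close>

definition resample :: "'a set \<Rightarrow> 'a set \<Rightarrow> 'a set \<Rightarrow> 'a set" where
  "resample E X Y = (X - E) \<union> (Y \<inter> E)"

text \<open>
  The exponent is exact for \<open>w = l \<cdot> (1\<^bsub>P\<^esub> + 1\<^bsub>Q\<^esub>)\<close> because \<open>exp (l (a + b)) - 1\<close> equals
  \<open>(exp l - 1) (a + b) + (exp l - 1)\<^sup>2 a b\<close> for \<open>a, b \<in> {0, 1}\<close>; only positions outside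
  \<open>E\<close> are shared between the two copies.
\<close>

lemma prob_two_replicas:
  assumes "finite A" "0 \<le> p" "p \<le> 1" "P \<subseteq> A" "Q \<subseteq> A" "0 \<le> l"
  shows "measure_pmf.prob (pair_pmf (random_subset A p) (random_subset A p))
      {(X, Y). real (card (X \<inter> P)) + real (card (resample E X Y \<inter> Q)) \<ge> t}
    \<le> exp (p * ((exp l - 1) * (card P + card Q) + (exp l - 1)\<^sup>2 * card (P \<inter> Q - E)) - l * t)"
proof -
  define M where "M = random_subset A p"
  define m where "m = exp l - 1"
  have fin: "finite (set_pmf M)" unfolding M_def using assms(1) by (rule finite_set_pmf_random_subset)
  \<comment> \<open>Positions of \<open>Q\<close> outside \<open>E\<close> are read from X and those
    inside from Y. Sorting them this way makes the tilted weight a function of X times a function of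
    Y, whose expectations multiply.\<close>
  define w where "w e = l * of_bool (e \<in> P) + l * of_bool (e \<in> Q - E)" for e
  define w' where "w' e = l * of_bool (e \<in> Q \<inter> E)" for e
  define u where "u X = exp (\<Sum>e\<in>A. w e * of_bool (e \<in> X))" for X
  define u' where "u' Y = exp (\<Sum>e\<in>A. w' e * of_bool (e \<in> Y))" for Y
  have u_eq: "u X * u' Y = exp (l * (real (card (X \<inter> P)) + real (card (resample E X Y \<inter> Q))))" for X Y
  proof -
    have fQ: "finite Q" using assms finite_subset by blast
    have "(\<Sum>e\<in>A. w e * of_bool (e \<in> X))
      = (\<Sum>e\<in>A. l * of_bool (e \<in> X \<inter> P) + l * of_bool (e \<in> X \<inter> (Q - E)))"
      unfolding w_def by (intro sum.cong) auto
    also have "\<dots> = l * card (X \<inter> P) + l * card (X \<inter> (Q - E))"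
      unfolding sum.distrib using assms(4,5)
      by (intro arg_cong2[of _ _ _ _ "(+)"] sum_indicator_card assms(1)) auto
    finally have 1: "(\<Sum>e\<in>A. w e * of_bool (e \<in> X)) = l * card (X \<inter> P) + l * card (X \<inter> (Q - E))" .
    have "(\<Sum>e\<in>A. w' e * of_bool (e \<in> Y)) = (\<Sum>e\<in>A. l * of_bool (e \<in> Y \<inter> (Q \<inter> E)))"
      unfolding w'_def by (intro sum.cong) auto
    also have "\<dots> = l * card (Y \<inter> (Q \<inter> E))"
      using assms(5) by (intro sum_indicator_card assms(1)) auto
    finally have 2: "(\<Sum>e\<in>A. w' e * of_bool (e \<in> Y)) = l * card (Y \<inter> (Q \<inter> E))" .
    have "resample E X Y \<inter> Q = (X \<inter> (Q - E)) \<union> (Y \<inter> (Q \<inter> E))"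
      by (auto simp: resample_def)
    then have "card (resample E X Y \<inter> Q) = card (X \<inter> (Q - E)) + card (Y \<inter> (Q \<inter> E))"
      using fQ by (simp add: card_Un_disjoint disjoint_iff)
    then show ?thesis unfolding u_def u'_def 1 2 by (simp add: exp_add[symmetric] algebra_simps)
  qed
  have "measure_pmf.prob (pair_pmf M M) {(X, Y). real (card (X \<inter> P)) + real (card (resample E X Y \<inter> Q)) \<ge> t}
      \<le> measure_pmf.prob (pair_pmf M M) {z\<in>space (pair_pmf M M). u (fst z) * u' (snd z) \<ge> exp (l * t)}"
    by (intro measure_pmf.finite_measure_mono) (auto simp: u_eq intro!: mult_left_mono assms)
  also have "\<dots> \<le> measure_pmf.expectation (pair_pmf M M) (\<lambda>z. u (fst z) * u' (snd z)) / exp (l * t)"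
    by (rule integral_Markov_inequality_measure[where A="{}"])
       (auto intro!: integrable_measure_pmf_finite fin simp: u_def u'_def)
  also have "measure_pmf.expectation (pair_pmf M M) (\<lambda>z. u (fst z) * u' (snd z))
      = measure_pmf.expectation M u * measure_pmf.expectation M u'"
    by (rule expectation_pair_pmf_mult[OF fin fin])
  also have "\<dots> \<le> exp (p * (\<Sum>e\<in>A. exp (w e) - 1)) * exp (p * (\<Sum>e\<in>A. exp (w' e) - 1))"
  proof (rule mult_mono)
    show "measure_pmf.expectation M u \<le> exp (p * (\<Sum>e\<in>A. exp (w e) - 1))"
      unfolding M_def u_def by (rule expectation_exp_random_subset_le[OF assms(1-3)])
    show "measure_pmf.expectation M u' \<le> exp (p * (\<Sum>e\<in>A. exp (w' e) - 1))"
      unfolding M_def u'_def by (rule expectation_exp_random_subset_le[OF assms(1-3)])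
  qed (auto simp: u'_def intro!: integral_nonneg_AE)
  also have "\<dots> = exp (p * ((\<Sum>e\<in>A. exp (w e) - 1) + (\<Sum>e\<in>A. exp (w' e) - 1)))"
    by (simp add: exp_add[symmetric] algebra_simps)
  also have "(\<Sum>e\<in>A. exp (w e) - 1) + (\<Sum>e\<in>A. exp (w' e) - 1)
      = (\<Sum>e\<in>A. m * of_bool (e \<in> P) + m * of_bool (e \<in> Q) + m\<^sup>2 * of_bool (e \<in> P \<inter> Q - E))"
    unfolding sum.distrib[symmetric]
    by (intro sum.cong) (auto simp: w_def w'_def m_def exp_add power2_eq_square algebra_simps)
  also have "\<dots> = m * (card P + card Q) + m\<^sup>2 * card (P \<inter> Q - E)"
    unfolding sum.distrib using assms(1,4,5)
    by (subst (1 2 3) sum_indicator_card) (auto simp: algebra_simps)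
  finally show ?thesis unfolding M_def m_def by (simp add: exp_diff divide_right_mono)
qed

subsection \<open>Overlaps and permutations\<close>

text \<open>For fixed H and permutation the overlap is linear in the membership bits of G: it counts
  the hits of G in the pullback of H. This is the form to which the bounds on random subsets
  apply.\<close>

lemma overlap_eq_card:
  assumes "\<pi> permutes {1..n}" "G \<subseteq> nsets {1..n} 2"
  shows "overlap n G H \<pi> = card (G \<inter> {e \<in> nsets {1..n} 2. \<pi> ` e \<in> H})"
proof -
  let ?I = "{(i, j). 1 \<le> i \<and> i < j \<and> j \<le> n}"
  have bij: "bij_betw (\<lambda>(i, j). {i, j}) ?I (nsets {1..n} 2)"
  proof (rule bij_betwI')
    fix z z' assume "z \<in> ?I" "z' \<in> ?I"
    then show "((case z of (i, j) \<Rightarrow> {i, j}) = (case z' of (i, j) \<Rightarrow> {i, j})) = (z = z')"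
      by (auto simp: doubleton_eq_iff)
  next
    fix z assume "z \<in> ?I"
    then show "(case z of (i, j) \<Rightarrow> {i, j}) \<in> nsets {1..n} 2" by auto
  next
    fix e assume "e \<in> nsets {1..n} 2"
    then obtain x y where e: "e = {x, y}" "x \<in> {1..n}" "y \<in> {1..n}" "x \<noteq> y" by (rule nsets2_E)
    then show "\<exists>z\<in>?I. e = (case z of (i, j) \<Rightarrow> {i, j})"
      by (intro bexI[of _ "(min x y, max x y)"]) (auto simp: min_def max_def)
  qed
  have "overlap n G H \<pi> = (\<Sum>z\<in>?I. (\<lambda>e. of_bool (e \<in> G \<inter> {e \<in> nsets {1..n} 2. \<pi> ` e \<in> H})) ((\<lambda>(i, j). {i, j}) z))"
    unfolding overlap_def by (intro sum.cong) (auto simp: adj_def)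
  also have "\<dots> = (\<Sum>e\<in>nsets {1..n} 2. of_bool (e \<in> G \<inter> {e \<in> nsets {1..n} 2. \<pi> ` e \<in> H}))"
    by (rule sum.reindex_bij_betw[OF bij])
  also have "\<dots> = card (G \<inter> {e \<in> nsets {1..n} 2. \<pi> ` e \<in> H})"
    using sum_indicator_card[of "nsets {1..n} 2" "G \<inter> {e \<in> nsets {1..n} 2. \<pi> ` e \<in> H}" 1] assms(2)
    by (simp add: finite_imp_finite_nsets Int_lower1 le_infI2)
  finally show ?thesis .
qed

lemma permutes_bij_betw_nsets: "\<pi> permutes A \<Longrightarrow> bij_betw ((`) \<pi>) (nsets A k) (nsets A k)"
  by (intro bij_betw_nsets permutes_imp_bij)

lemma card_permuted_edges:
  assumes "\<pi> permutes A" "H \<subseteq> nsets A k"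
  shows "card {e \<in> nsets A k. \<pi> ` e \<in> H} = card H"
proof -
  have "bij_betw ((`) \<pi>) {e \<in> nsets A k. \<pi> ` e \<in> H} H"
  proof (rule bij_betw_subset[OF permutes_bij_betw_nsets[OF assms(1), of k]])
    show "(`) \<pi> ` {e \<in> nsets A k. \<pi> ` e \<in> H} = H"
    proof (intro equalityI subsetI)
      fix f assume f: "f \<in> H"
      then have "f \<in> (`) \<pi> ` nsets A k"
        using bij_betw_imp_surj_on[OF permutes_bij_betw_nsets[OF assms(1), of k]] assms(2) by auto
      then show "f \<in> (`) \<pi> ` {e \<in> nsets A k. \<pi> ` e \<in> H}"
        using f by auto
    qed auto
  qed auto
  then show ?thesis by (rule bij_betw_same_card)
qed

text \<open>Transport along \<open>\<pi>\<close> reduces the covariance of two alignments to the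
  single permutation \<open>\<pi>' \<circ> inv \<pi>\<close>, so host typicality need only be a
  union over permutations, not over pairs.\<close>

lemma card_common_edges:
  assumes "\<pi> permutes A" "\<pi>' permutes A"
  shows "card ({e \<in> nsets A k. \<pi> ` e \<in> H} \<inter> {e \<in> nsets A k. \<pi>' ` e \<in> H})
    = card {f \<in> nsets A k. f \<in> H \<and> (\<pi>' \<circ> inv \<pi>) ` f \<in> H}"
proof -
  have "bij_betw ((`) \<pi>) ({e \<in> nsets A k. \<pi> ` e \<in> H} \<inter> {e \<in> nsets A k. \<pi>' ` e \<in> H})
      {f \<in> nsets A k. f \<in> H \<and> (\<pi>' \<circ> inv \<pi>) ` f \<in> H}"
  proof (rule bij_betw_subset[OF permutes_bij_betw_nsets[OF assms(1), of k]])
    have *: "(\<pi>' \<circ> inv \<pi>) ` \<pi> ` e = \<pi>' ` e" for e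
      using permutes_inverses(2)[OF assms(1)] by (simp add: image_comp o_def)
    show "(`) \<pi> ` ({e \<in> nsets A k. \<pi> ` e \<in> H} \<inter> {e \<in> nsets A k. \<pi>' ` e \<in> H})
      = {f \<in> nsets A k. f \<in> H \<and> (\<pi>' \<circ> inv \<pi>) ` f \<in> H}"
    proof (intro equalityI subsetI)
      fix f assume "f \<in> (`) \<pi> ` ({e \<in> nsets A k. \<pi> ` e \<in> H} \<inter> {e \<in> nsets A k. \<pi>' ` e \<in> H})"
      then show "f \<in> {f \<in> nsets A k. f \<in> H \<and> (\<pi>' \<circ> inv \<pi>) ` f \<in> H}"
        using bij_betwE[OF permutes_bij_betw_nsets[OF assms(1), of k]] * by force
    next
      fix f assume f: "f \<in> {f \<in> nsets A k. f \<in> H \<and> (\<pi>' \<circ> inv \<pi>) ` f \<in> H}"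
      then obtain e where "e \<in> nsets A k" "f = \<pi> ` e"
        using bij_betw_imp_surj_on[OF permutes_bij_betw_nsets[OF assms(1), of k]] by blast
      then show "f \<in> (`) \<pi> ` ({e \<in> nsets A k. \<pi> ` e \<in> H} \<inter> {e \<in> nsets A k. \<pi>' ` e \<in> H})"
        using f * by auto
    qed
  qed auto
  then show ?thesis by (rule bij_betw_same_card)
qed

text \<open>An edge kept as a set is either fixed pointwise or swapped. A swapped edge has the form
  {i, sigma i}, so there are at most \<open>card A\<close> of them, a term of lower order than the
  squared size.\<close>

lemma card_fixed_edges_le:
  fixes \<sigma> :: "'a \<Rightarrow> 'a"
  assumes "finite A"
  shows "real (card {e \<in> nsets A 2. \<sigma> ` e = e}) \<le> (real (card {i\<in>A. \<sigma> i = i}))\<^sup>2 / 2 + card A"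
proof -
  let ?F = "{i\<in>A. \<sigma> i = i}"
  have "{e \<in> nsets A 2. \<sigma> ` e = e} \<subseteq> nsets ?F 2 \<union> (\<lambda>i. {i, \<sigma> i}) ` A"
  proof
    fix e assume "e \<in> {e \<in> nsets A 2. \<sigma> ` e = e}"
    then obtain x y where e: "e = {x, y}" "x \<in> A" "y \<in> A" "x \<noteq> y" "\<sigma> ` e = e"
      by (auto elim!: nsets2_E)
    then have "(\<sigma> x = x \<and> \<sigma> y = y) \<or> (\<sigma> x = y)"
      by (auto simp: doubleton_eq_iff)
    then show "e \<in> nsets ?F 2 \<union> (\<lambda>i. {i, \<sigma> i}) ` A"
      using e by auto
  qed
  then have "card {e \<in> nsets A 2. \<sigma> ` e = e} \<le> card (nsets ?F 2 \<union> (\<lambda>i. {i, \<sigma> i}) ` A)"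
    using assms by (intro card_mono) (auto intro!: finite_imp_finite_nsets)
  also have "\<dots> \<le> card (nsets ?F 2) + card ((\<lambda>i. {i, \<sigma> i}) ` A)"
    by (rule card_Un_le)
  also have "card ((\<lambda>i. {i, \<sigma> i}) ` A) \<le> card A" by (rule card_image_le[OF assms])
  finally have "real (card {e \<in> nsets A 2. \<sigma> ` e = e}) \<le> real (card ?F choose 2) + card A" by simp
  also have "real (card ?F choose 2) \<le> (real (card ?F))\<^sup>2 / 2"
  proof -
    have "real (card ?F choose 2) = real (card ?F) * (real (card ?F) - 1) / 2"
      using gbinomial_pochhammer[of "real (card ?F)" 2]
      by (simp add: binomial_gbinomial gbinomial_prod_rev numeral_2_eq_2)
    also have "\<dots> \<le> (real (card ?F))\<^sup>2 / 2"
      by (simp add: power2_eq_square algebra_simps)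
    finally show ?thesis .
  qed
  finally show ?thesis by simp
qed

section \<open>Counting pairs of permutations by agreement\<close>

lemma card_agreeing_permutations_le:
  assumes "finite A" "S \<subseteq> A" "\<pi> permutes A"
  shows "card {\<pi>'. \<pi>' permutes A \<and> (\<forall>i\<in>S. \<pi>' i = \<pi> i)} \<le> card A ^ (card A - card S)"
proof -
  have "card {\<pi>'. \<pi>' permutes A \<and> (\<forall>i\<in>S. \<pi>' i = \<pi> i)} \<le> card (PiE (A - S) (\<lambda>_. A))"
  proof (rule card_inj_on_le[of "\<lambda>\<pi>'. restrict \<pi>' (A - S)"])
    show "inj_on (\<lambda>\<pi>'. restrict \<pi>' (A - S)) {\<pi>'. \<pi>' permutes A \<and> (\<forall>i\<in>S. \<pi>' i = \<pi> i)}"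
    proof (rule inj_onI, rule ext)
      fix f g x
      assume f: "f \<in> {\<pi>'. \<pi>' permutes A \<and> (\<forall>i\<in>S. \<pi>' i = \<pi> i)}"
        and g: "g \<in> {\<pi>'. \<pi>' permutes A \<and> (\<forall>i\<in>S. \<pi>' i = \<pi> i)}"
        and eq: "restrict f (A - S) = restrict g (A - S)"
      consider "x \<in> S" | "x \<in> A - S" | "x \<notin> A" by blast
      then show "f x = g x"
      proof cases
        case 2 then show ?thesis using fun_cong[OF eq, of x] by simp
      qed (use f g in \<open>auto simp: permutes_not_in\<close>)
    qed
    show "(\<lambda>\<pi>'. restrict \<pi>' (A - S)) ` {\<pi>'. \<pi>' permutes A \<and> (\<forall>i\<in>S. \<pi>' i = \<pi> i)} \<subseteq> PiE (A - S) (\<lambda>_. A)"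
      using permutes_in_image by fastforce
    show "finite (PiE (A - S) (\<lambda>_. A))" using assms(1) by (intro finite_PiE) auto
  qed
  also have "card (PiE (A - S) (\<lambda>_. A)) = card A ^ card (A - S)"
    using assms(1) by (simp add: card_PiE)
  also have "card (A - S) = card A - card S"
    using assms by (simp add: card_Diff_subset finite_subset)
  finally show ?thesis .
qed

text \<open>Union over the possible agreement sets. The factor \<open>2 ^ n\<close> for choosing
  one, like the crude n^(n - |S|) instead of a factorial, is invisible on the scale n^(const
  n).\<close>

lemma card_permutation_pairs_le:
  assumes "n \<ge> 1" "0 \<le> \<rho>"
  shows "real (card {(\<pi>, \<pi>'). \<pi> permutes {1..n} \<and> \<pi>' permutes {1..n} \<and> real (card {i\<in>{1..n}. \<pi> i = \<pi>' i}) \<ge> \<rho> * n})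
    \<le> real n ^ n * 2 ^ n * real n powr ((1 - \<rho>) * n)"
proof -
  define A where "A = {1..n}"
  have A: "finite A" "card A = n" by (simp_all add: A_def)
  define T where "T \<pi> S = {\<pi>'. \<pi>' permutes A \<and> (\<forall>i\<in>S. \<pi>' i = \<pi> i)}" for \<pi> :: "nat \<Rightarrow> nat" and S
  define \<S> where "\<S> = {S\<in>Pow A. real (card S) \<ge> \<rho> * n}"
  define R where "R \<pi> = {\<pi>'. \<pi>' permutes A \<and> real (card {i\<in>A. \<pi> i = \<pi>' i}) \<ge> \<rho> * n}" for \<pi> :: "nat \<Rightarrow> nat"
  have finperm: "finite {\<pi>. \<pi> permutes A}" using A(1) by (rule finite_permutations)
  have R_le: "real (card (R \<pi>)) \<le> 2 ^ n * real n powr ((1 - \<rho>) * n)" if "\<pi> permutes A" for \<pi>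
  proof -
    have "R \<pi> \<subseteq> (\<Union>S\<in>\<S>. T \<pi> S)"
    proof
      fix \<pi>' assume "\<pi>' \<in> R \<pi>"
      then have "{i\<in>A. \<pi> i = \<pi>' i} \<in> \<S>" "\<pi>' \<in> T \<pi> {i\<in>A. \<pi> i = \<pi>' i}" by (auto simp: R_def \<S>_def T_def)
      then show "\<pi>' \<in> (\<Union>S\<in>\<S>. T \<pi> S)" by blast
    qed
    moreover have "finite (\<Union>S\<in>\<S>. T \<pi> S)"
      by (rule finite_subset[OF _ finperm]) (auto simp: T_def)
    ultimately have "card (R \<pi>) \<le> card (\<Union>S\<in>\<S>. T \<pi> S)" by (intro card_mono)
    also have "\<dots> \<le> (\<Sum>S\<in>\<S>. card (T \<pi> S))" by (rule card_UN_le) (use A in \<open>simp add: \<S>_def\<close>)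
    finally have "real (card (R \<pi>)) \<le> (\<Sum>S\<in>\<S>. real (card (T \<pi> S)))" by (simp flip: of_nat_sum)
    also have "\<dots> \<le> (\<Sum>S\<in>\<S>. real n powr ((1 - \<rho>) * n))"
    proof (rule sum_mono)
      fix S assume "S \<in> \<S>"
      then have S: "S \<subseteq> A" "real (card S) \<ge> \<rho> * n" by (auto simp: \<S>_def)
      have cS: "card S \<le> n" using card_mono[OF A(1) S(1)] A by simp
      have "card (T \<pi> S) \<le> n ^ (n - card S)"
        unfolding T_def using card_agreeing_permutations_le[OF A(1) S(1) that] A by simp
      then have "real (card (T \<pi> S)) \<le> real n ^ (n - card S)"
        by (metis of_nat_le_iff of_nat_power)
      also have "\<dots> = real n powr (real n - real (card S))"
        using assms cS by (simp add: powr_realpow[symmetric] of_nat_diff)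
      also have "\<dots> \<le> real n powr ((1 - \<rho>) * n)"
        using assms S(2) by (intro powr_mono) (auto simp: algebra_simps)
      finally show "real (card (T \<pi> S)) \<le> real n powr ((1 - \<rho>) * n)" .
    qed
    also have "\<dots> = card \<S> * real n powr ((1 - \<rho>) * n)" by simp
    also have "\<dots> \<le> 2 ^ n * real n powr ((1 - \<rho>) * n)"
    proof (rule mult_right_mono)
      have "card \<S> \<le> card (Pow A)" using A(1) by (intro card_mono) (auto simp: \<S>_def)
      then have "card \<S> \<le> 2 ^ n" using A by (simp add: card_Pow)
      then show "real (card \<S>) \<le> 2 ^ n" by (metis of_nat_le_iff of_nat_numeral of_nat_power)
    qed simp
    finally show ?thesis .
  qed
  have "{(\<pi>, \<pi>'). \<pi> permutes {1..n} \<and> \<pi>' permutes {1..n} \<and> real (card {i\<in>{1..n}. \<pi> i = \<pi>' i}) \<ge> \<rho> * n}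
     = Sigma {\<pi>. \<pi> permutes A} R"
    by (auto simp: R_def A_def)
  moreover have "card (Sigma {\<pi>. \<pi> permutes A} R) = (\<Sum>\<pi>\<in>{\<pi>. \<pi> permutes A}. card (R \<pi>))"
    by (intro card_SigmaI finperm ballI finite_subset[OF _ finperm]) (auto simp: R_def)
  moreover have "real (\<Sum>\<pi>\<in>{\<pi>. \<pi> permutes A}. card (R \<pi>))
      \<le> real n ^ n * 2 ^ n * real n powr ((1 - \<rho>) * n)"
  proof -
    have "real (\<Sum>\<pi>\<in>{\<pi>. \<pi> permutes A}. card (R \<pi>))
        \<le> (\<Sum>\<pi>\<in>{\<pi>. \<pi> permutes A}. 2 ^ n * real n powr ((1 - \<rho>) * n))"
      unfolding of_nat_sum by (intro sum_mono R_le) auto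
    also have "\<dots> = fact n * (2 ^ n * real n powr ((1 - \<rho>) * n))"
      using A by (simp add: card_permutations)
    also have "\<dots> \<le> real n ^ n * (2 ^ n * real n powr ((1 - \<rho>) * n))"
      using fact_le_power[of n, where 'a=real] by (intro mult_right_mono) auto
    finally show ?thesis by (simp add: mult.assoc)
  qed
  ultimately show ?thesis by metis
qed

subsection \<open>The first moment bound\<close>

text \<open>The slack in the first clause is epsilon D / p with D = \<open>D_scale n p\<close>: such
  an excess of edges moves the mean overlap by only epsilon D. In the second clause the leading term
  is p times the main count of edges fixed by \<open>\<sigma>\<close>; swapped edges, displaced
  edges and fluctuations go into the epsilon term.\<close>

definition typical_host :: "nat \<Rightarrow> real \<Rightarrow> real \<Rightarrow> graph \<Rightarrow> bool" where
  "typical_host n p \<epsilon> H \<longleftrightarrow>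
     real (card H) \<le> p * real (n choose 2) + \<epsilon> * (n * sqrt (n * ln n)) \<and>
     (\<forall>\<sigma>. \<sigma> permutes {1..n} \<longrightarrow>
       real (card {e \<in> nsets {1..n} 2. e \<in> H \<and> \<sigma> ` e \<in> H})
         \<le> p * ((real (card {i\<in>{1..n}. \<sigma> i = i}))\<^sup>2 / 2 + \<epsilon> * (real n)\<^sup>2))"

lemma choose_two_le: "real (n choose 2) \<le> (real n)\<^sup>2 / 2"
proof -
  have "n choose 2 \<le> n * n div 2" by (simp add: choose_two div_le_mono)
  then have "real (n choose 2) \<le> real (n * n div 2)" by (rule of_nat_mono)
  also have "\<dots> \<le> real (n * n) / 2" by (metis of_nat_div_le_of_nat of_nat_numeral)
  finally show ?thesis by (simp add: power2_eq_square)
qed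

lemma prob_excess_edges:
  assumes "0 \<le> p" "p \<le> 1" "1 \<le> n"
  shows "measure_pmf.prob (erdos_renyi n p)
      {H. \<not> real (card H) \<le> p * real (n choose 2) + \<epsilon> * (n * sqrt (n * ln n))}
    \<le> exp (n - \<epsilon> * (n * sqrt (ln n)))"
proof -
  let ?A = "nsets {1..n} 2"
  have fin: "finite ?A" by (simp add: finite_imp_finite_nsets)
  \<comment> \<open>This tilt brings the quadratic term down to at most n, while the linear gain
    epsilon n sqrt(ln n) is larger by an unbounded factor.\<close>
  define l where "l = 1 / sqrt n"
  have l: "0 \<le> l" "l \<le> 1" "l\<^sup>2 = 1 / n" using assms(3) by (auto simp: l_def power_divide)
  have "measure_pmf.prob (erdos_renyi n p)
      {H. \<not> real (card H) \<le> p * real (n choose 2) + \<epsilon> * (n * sqrt (n * ln n))}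
    \<le> measure_pmf.prob (random_subset ?A p)
      {X. real (card (X \<inter> ?A)) \<ge> p * card ?A + \<epsilon> * (n * sqrt (n * ln n))}"
    unfolding erdos_renyi_eq_random_subset
  proof (rule measure_pmf.finite_measure_mono_AE, unfold AE_measure_pmf_iff, rule ballI, rule impI)
    fix X assume "X \<in> set_pmf (random_subset ?A p)"
    then have "X \<inter> ?A = X" using set_pmf_random_subset by blast
    then show "X \<in> {H. \<not> real (card H) \<le> p * real (n choose 2) + \<epsilon> * (n * sqrt (n * ln n))} \<Longrightarrow>
      X \<in> {X. real (card (X \<inter> ?A)) \<ge> p * card ?A + \<epsilon> * (n * sqrt (n * ln n))}" by simp
  qed auto
  also have "\<dots> \<le> exp (p * card ?A * l\<^sup>2 - l * (\<epsilon> * (n * sqrt (n * ln n))))"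
    by (rule prob_random_subset_chernoff[OF fin assms(1,2) subset_refl l(1,2)])
  also have "\<dots> \<le> exp (n - \<epsilon> * (n * sqrt (ln n)))"
  proof -
    have "p * card ?A * l\<^sup>2 \<le> 1 * (real n)\<^sup>2 * (1 / n)"
      unfolding l(3)
    proof (intro mult_mono)
      show "real (card ?A) \<le> (real n)\<^sup>2"
      proof -
        have "real (card ?A) = real (n choose 2)" by simp
        also have "\<dots> \<le> (real n)\<^sup>2 / 2" by (rule choose_two_le)
        also have "\<dots> \<le> (real n)\<^sup>2" by simp
        finally show ?thesis .
      qed
    qed (use assms in auto)
    also have "\<dots> = n" using assms(3) by (simp add: power2_eq_square)
    finally have "p * card ?A * l\<^sup>2 \<le> n" .
    moreover have "l * (\<epsilon> * (n * sqrt (n * ln n))) = \<epsilon> * (n * sqrt (ln n))"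
      using assms(3) by (simp add: l_def real_sqrt_mult)
    ultimately show ?thesis by (simp only: exp_le_cancel_iff)
  qed
  finally show ?thesis .
qed

text \<open>Fixed edges need one edge of H each, hence a linear count handled by Chernoff; displaced
  edges need two, hence the bound for patterns x, f x, whose mean is of order p^2 n^2 and is beaten
  through the smallness of p.\<close>

lemma prob_excess_common_edges:
  assumes "0 \<le> p" "p \<le> 1" "0 < \<epsilon>" "\<epsilon> \<le> 1" "exp (18 / \<epsilon>) * p \<le> 2" "3 / \<epsilon> \<le> n"
    and "\<sigma> permutes {1..n}"
  shows "measure_pmf.prob (erdos_renyi n p)
      {H. \<not> real (card {e \<in> nsets {1..n} 2. e \<in> H \<and> \<sigma> ` e \<in> H})
         \<le> p * ((real (card {i\<in>{1..n}. \<sigma> i = i}))\<^sup>2 / 2 + \<epsilon> * (real n)\<^sup>2)}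
    \<le> exp (- (real n)\<^sup>2 * p * \<epsilon>\<^sup>2 / 18) + exp (- (real n)\<^sup>2 * p)"
proof -
  let ?A = "nsets {1..n} 2"
  let ?M = "random_subset ?A p"
  let ?m = "card {i\<in>{1..n}. \<sigma> i = i}"
  define Fix where "Fix = {e \<in> ?A. \<sigma> ` e = e}"
  define D where "D H = {e \<in> ?A. e \<in> H \<and> \<sigma> ` e \<in> H \<and> \<sigma> ` e \<noteq> e}" for H
  \<comment> \<open>One third of the slack epsilon p n^2. The other two thirds go to the term n from
    swapped edges, using \<open>3 / \<epsilon> \<le> n\<close>, and to the displaced edges, for
    which the slack is written \<open>3 * (T / 3)\<close> to match the factor 3 of the
    independent-subset bound.\<close>
  define T where "T = (real n)\<^sup>2 * p * \<epsilon> / 3"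
  have fin: "finite ?A" by (simp add: finite_imp_finite_nsets)
  have Fix: "Fix \<subseteq> ?A" by (auto simp: Fix_def)
  have "card Fix \<le> card ?A" using Fix fin by (rule card_mono[rotated])
  then have cFix: "real (card Fix) \<le> (real n)\<^sup>2 / 2" using choose_two_le[of n] by simp
  have "real (card Fix) \<le> (real ?m)\<^sup>2 / 2 + n"
    unfolding Fix_def using card_fixed_edges_le[of "{1..n}" \<sigma>] by simp
  moreover have "n \<le> \<epsilon> * (real n)\<^sup>2 / 3"
  proof -
    have "3 * real n \<le> (\<epsilon> * n) * n" using assms(3,6) by (intro mult_right_mono) (auto simp: field_simps)
    then show ?thesis by (simp add: power2_eq_square)
  qed
  ultimately have "p * card Fix \<le> p * ((real ?m)\<^sup>2 / 2 + \<epsilon> * (real n)\<^sup>2 / 3)"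
    using assms(1) by (intro mult_left_mono) auto
  then have main: "p * card Fix + T + 3 * (T / 3) \<le> p * ((real ?m)\<^sup>2 / 2 + \<epsilon> * (real n)\<^sup>2)"
    by (simp add: T_def algebra_simps)
  have "measure_pmf.prob (erdos_renyi n p)
      {H. \<not> real (card {e \<in> ?A. e \<in> H \<and> \<sigma> ` e \<in> H}) \<le> p * ((real ?m)\<^sup>2 / 2 + \<epsilon> * (real n)\<^sup>2)}
    \<le> measure_pmf.prob ?M ({H. real (card (H \<inter> Fix)) \<ge> p * card Fix + T} \<union> {H. real (card (D H)) \<ge> 3 * (T / 3)})"
    unfolding erdos_renyi_eq_random_subset
  proof (rule measure_pmf.finite_measure_mono, rule subsetI, rule ccontr)
    fix H assume H: "H \<in> {H. \<not> real (card {e \<in> ?A. e \<in> H \<and> \<sigma> ` e \<in> H}) \<le> p * ((real ?m)\<^sup>2 / 2 + \<epsilon> * (real n)\<^sup>2)}"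
      and "H \<notin> {H. real (card (H \<inter> Fix)) \<ge> p * card Fix + T} \<union> {H. real (card (D H)) \<ge> 3 * (T / 3)}"
    then have "real (card (H \<inter> Fix)) + real (card (D H)) < p * card Fix + T + 3 * (T / 3)" by auto
    moreover have "card {e \<in> ?A. e \<in> H \<and> \<sigma> ` e \<in> H} \<le> card (H \<inter> Fix) + card (D H)"
    proof -
      have "{e \<in> ?A. e \<in> H \<and> \<sigma> ` e \<in> H} = (H \<inter> Fix) \<union> D H" by (auto simp: Fix_def D_def)
      then show ?thesis using card_Un_le[of "H \<inter> Fix" "D H"] by simp
    qed
    ultimately show False using H main by simp
  qed auto
  also have "\<dots> \<le> measure_pmf.prob ?M {H. real (card (H \<inter> Fix)) \<ge> p * card Fix + T}
      + measure_pmf.prob ?M {H. real (card (D H)) \<ge> 3 * (T / 3)}"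
    by (rule measure_Un_le) auto
  \<comment> \<open>Tilt epsilon / 3: the cost is at most n^2 p epsilon^2 / 18 and the gain is n^2 p
    epsilon^2 / 9.\<close>
  also have "measure_pmf.prob ?M {H. real (card (H \<inter> Fix)) \<ge> p * card Fix + T}
      \<le> exp (p * card Fix * (\<epsilon> / 3)\<^sup>2 - \<epsilon> / 3 * T)"
    using assms(3,4) by (intro prob_random_subset_chernoff fin assms(1,2) Fix) auto
  also have "\<dots> \<le> exp (- (real n)\<^sup>2 * p * \<epsilon>\<^sup>2 / 18)"
  proof -
    have "p * card Fix * (\<epsilon> / 3)\<^sup>2 \<le> p * ((real n)\<^sup>2 / 2) * (\<epsilon> / 3)\<^sup>2"
      using assms(1) cFix by (intro mult_right_mono mult_left_mono) auto
    then show ?thesis by (simp add: T_def power2_eq_square algebra_simps)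
  qed
  \<comment> \<open>The weight 18 / epsilon turns the gain into 2 n^2 p, while
    \<open>exp (18 / \<epsilon>) * p \<le> 2\<close> caps the cost at n^2 p.\<close>
  also have "measure_pmf.prob ?M {H. real (card (D H)) \<ge> 3 * (T / 3)}
      \<le> exp (exp (18 / \<epsilon>) * p\<^sup>2 * card ?A - 18 / \<epsilon> * (T / 3))"
    unfolding D_def
  proof (rule prob_random_subset_displaced[OF fin assms(1,2)])
    show "(`) \<sigma> ` ?A \<subseteq> ?A" "inj_on ((`) \<sigma>) ?A"
      using permutes_bij_betw_nsets[OF assms(7), of 2] by (auto simp: bij_betw_def)
  qed (use assms(3) in auto)
  also have "\<dots> \<le> exp (- (real n)\<^sup>2 * p)"
  proof -
    have "exp (18 / \<epsilon>) * p\<^sup>2 * card ?A = (exp (18 / \<epsilon>) * p) * (p * real (n choose 2))"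
      by (simp add: power2_eq_square)
    also have "\<dots> \<le> 2 * (p * ((real n)\<^sup>2 / 2))"
      using assms(1,5) choose_two_le[of n] by (intro mult_mono mult_left_mono) auto
    finally have "exp (18 / \<epsilon>) * p\<^sup>2 * card ?A \<le> (real n)\<^sup>2 * p" by (simp add: mult.commute)
    moreover have "18 / \<epsilon> * (T / 3) = 2 * ((real n)\<^sup>2 * p)" using assms(3) by (simp add: T_def)
    ultimately show ?thesis by (simp only: exp_le_cancel_iff mult_minus_left)
  qed
  finally show ?thesis by simp
qed

lemma prob_not_typical_host:
  assumes "0 \<le> p" "p \<le> 1" "0 < \<epsilon>" "\<epsilon> \<le> 1" "exp (18 / \<epsilon>) * p \<le> 2" "3 / \<epsilon> \<le> n"
  shows "measure_pmf.prob (erdos_renyi n p) {H. \<not> typical_host n p \<epsilon> H}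
    \<le> exp (n - \<epsilon> * (n * sqrt (ln n)))
      + real n ^ n * (exp (- (real n)\<^sup>2 * p * \<epsilon>\<^sup>2 / 18) + exp (- (real n)\<^sup>2 * p))"
proof -
  have n: "1 \<le> n"
  proof (rule ccontr)
    assume "\<not> 1 \<le> n"
    then have "n = 0" by simp
    then show False using assms(3,6) by (simp add: divide_le_0_iff)
  qed
  let ?P = "{\<sigma>. \<sigma> permutes {1..n}}"
  let ?c = "exp (- (real n)\<^sup>2 * p * \<epsilon>\<^sup>2 / 18) + exp (- (real n)\<^sup>2 * p)"
  let ?E = "{H. \<not> real (card H) \<le> p * real (n choose 2) + \<epsilon> * (n * sqrt (n * ln n))}"
  let ?S = "\<lambda>\<sigma>. {H. \<not> real (card {e \<in> nsets {1..n} 2. e \<in> H \<and> \<sigma> ` e \<in> H})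
         \<le> p * ((real (card {i\<in>{1..n}. \<sigma> i = i}))\<^sup>2 / 2 + \<epsilon> * (real n)\<^sup>2)}"
  have fin: "finite ?P" by (simp add: finite_permutations)
  have "{H. \<not> typical_host n p \<epsilon> H} = ?E \<union> (\<Union>\<sigma>\<in>?P. ?S \<sigma>)"
    by (auto simp: typical_host_def)
  then have "measure_pmf.prob (erdos_renyi n p) {H. \<not> typical_host n p \<epsilon> H}
     \<le> measure_pmf.prob (erdos_renyi n p) ?E + measure_pmf.prob (erdos_renyi n p) (\<Union>\<sigma>\<in>?P. ?S \<sigma>)"
    by (simp only:) (rule measure_Un_le; simp)
  also have "measure_pmf.prob (erdos_renyi n p) ?E \<le> exp (n - \<epsilon> * (n * sqrt (ln n)))"
    by (rule prob_excess_edges[OF assms(1,2) n])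
  also have "measure_pmf.prob (erdos_renyi n p) (\<Union>\<sigma>\<in>?P. ?S \<sigma>)
      \<le> (\<Sum>\<sigma>\<in>?P. measure_pmf.prob (erdos_renyi n p) (?S \<sigma>))"
    by (rule measure_pmf.finite_measure_subadditive_finite[OF fin]) auto
  also have "\<dots> \<le> (\<Sum>\<sigma>\<in>?P. ?c)"
    by (intro sum_mono prob_excess_common_edges assms) auto
  also have "\<dots> = fact n * ?c" by (simp add: card_permutations)
  also have "\<dots> \<le> real n ^ n * ?c"
    using fact_le_power[of n, where 'a=real] by (intro mult_right_mono) auto
  finally show ?thesis by simp
qed

section \<open>The sharp exponent for two replicas\<close>

text \<open>Here the coefficient 1/2 of l^2 must be exact, since it determines the constant in 2
  beta^2 / (1 + x^2). The cubic Taylor remainder is at most e l^3 / 6, hence at most l^3 / 2 by e <=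
  3.\<close>

lemma exp_minus_one_le_cubic:
  fixes l :: real
  assumes "0 \<le> l" "l \<le> 1"
  shows "exp l - 1 \<le> l + l\<^sup>2 / 2 * (1 + l)"
proof -
  obtain t where t: "\<bar>t\<bar> \<le> \<bar>l\<bar>" "exp l = (\<Sum>m<3. l ^ m / fact m) + exp t / fact 3 * l ^ 3"
    using Maclaurin_exp_le[of l 3] by blast
  have "exp t \<le> exp 1" using t(1) assms by simp
  also have "\<dots> \<le> 3" by (rule exp_le)
  finally have "exp t / fact 3 * l ^ 3 \<le> 3 / fact 3 * l ^ 3"
    using assms by (intro mult_right_mono divide_right_mono) auto
  then show ?thesis using t(2) by (simp add: eval_nat_numeral fact_numeral algebra_simps)
qed

text \<open>
  The choice \<open>l = 2 \<beta> r / v\<close> minimises the leading part \<open>v l\<^sup>2 n\<^sup>2 p\<^sup>2 / 2 - 2 l \<beta> D\<close> of the exponent,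
  where \<open>D = r n\<^sup>2 p\<^sup>2\<close> is the deviation scale.
\<close>

lemma two_replica_exponent:
  fixes n p \<epsilon> \<beta> x h N M L :: real
  defines "r \<equiv> sqrt (L / n) / p" and "v \<equiv> 1 + x\<^sup>2"
  assumes n: "0 < n" and L: "0 \<le> L" and p: "0 < p" and \<epsilon>: "0 < \<epsilon>" "\<epsilon> \<le> 1" and x: "0 \<le> x" "x \<le> 1"
    and \<beta>: "0 \<le> \<beta>" "\<beta> \<le> 1" and r: "6 * r \<le> \<epsilon>"
    and h: "h \<le> p * N + \<epsilon> * (n * sqrt (n * L))" and N: "0 \<le> N" "N \<le> n\<^sup>2 / 2"
    and M: "M \<le> p * (x\<^sup>2 / 2 + \<epsilon>) * n\<^sup>2"
    and l: "l = 2 * \<beta> * r / v"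
  shows "p * ((exp l - 1) * (2 * h) + (exp l - 1)\<^sup>2 * M) - l * (2 * (N * p\<^sup>2 + \<beta> * sqrt (n ^ 3 * p\<^sup>2 * L)))
    \<le> n * L * (20 * \<epsilon> - 2 * \<beta>\<^sup>2 / v)"
proof -
  define s where "s = 2 * \<beta> / v"
  define m where "m = exp l - 1"
  define D' where "D' = n * sqrt (n * L)"
  have v: "1 \<le> v" "v \<le> 2" using x by (auto simp: v_def power_le_one)
  have s: "0 \<le> s" "s \<le> 2" using \<beta> v by (auto simp: s_def divide_simps)
  have r0: "0 \<le> r" using n L p by (simp add: r_def)
  have ls: "l = s * r" by (simp add: l s_def)
  have l0: "0 \<le> l" using s r0 ls by simp
  have "l \<le> 2 * r" unfolding ls using s r0 by (intro mult_right_mono) auto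
  then have l3: "3 * l \<le> \<epsilon>" using r by simp
  then have l1: "l \<le> 1" using \<epsilon> l0 by simp
  have m0: "0 \<le> m" using l0 by (simp add: m_def)
  have m3: "m \<le> l + l\<^sup>2 / 2 * (1 + l)" unfolding m_def by (rule exp_minus_one_le_cubic[OF l0 l1])
  have "l\<^sup>2 / 2 * (1 + l) \<le> l\<^sup>2 / 2 * 2" using l1 by (intro mult_left_mono) auto
  then have m2: "m \<le> l * (1 + l)" using m3 by (simp add: power2_eq_square distrib_left)
  also have "\<dots> \<le> l * 2" using l0 l1 by (intro mult_left_mono) auto
  finally have m1: "m \<le> 2 * l" by simp
  have "m\<^sup>2 \<le> (l * (1 + l))\<^sup>2" using m0 m2 by (intro power_mono)
  also have "\<dots> = l\<^sup>2 * (1 + 2 * l + l * l)" by (simp add: power2_eq_square algebra_simps)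
  also have "\<dots> \<le> l\<^sup>2 * (1 + 3 * l)"
    using l0 l1 mult_left_le[of l l] by (intro mult_left_mono) auto
  also have "\<dots> \<le> l\<^sup>2 * (1 + \<epsilon>)" using l3 by (intro mult_left_mono) auto
  finally have msq: "m\<^sup>2 \<le> l\<^sup>2 * (1 + \<epsilon>)" .
  have D': "0 \<le> D'" using n L by (simp add: D'_def)
  have D: "sqrt (n ^ 3 * p\<^sup>2 * L) = p * D'"
  proof -
    have "n ^ 3 * p\<^sup>2 * L = (p * n)\<^sup>2 * (n * L)" by (simp add: power2_eq_square power3_eq_cube algebra_simps)
    then show ?thesis unfolding D'_def using n p by (simp only:) (simp add: real_sqrt_mult)
  qed
  have pr: "p * r = sqrt (L / n)" using p by (simp add: r_def)
  have "sqrt (L / n) * sqrt (n * L) = sqrt (L\<^sup>2)"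
    using n by (simp add: real_sqrt_mult[symmetric] power2_eq_square)
  then have q1: "sqrt (L / n) * sqrt (n * L) = L" using L by simp
  \<comment> \<open>From here on every term is a multiple of \<open>n * L\<close>: the tilt times D
    gives \<open>s * (n * L)\<close>, and n^2 p^2 l^2 gives
    \<open>s\<^sup>2 * (n * L)\<close>.\<close>
  have lpD: "l * (p * D') = s * (n * L)"
  proof -
    have "l * (p * D') = s * (p * r) * (n * sqrt (n * L))" by (simp add: ls D'_def)
    also have "\<dots> = s * n * (sqrt (L / n) * sqrt (n * L))" unfolding pr by simp
    finally show ?thesis unfolding q1 by simp
  qed
  have lp2: "(n\<^sup>2 * p\<^sup>2) * l\<^sup>2 = s\<^sup>2 * (n * L)"
  proof -
    have "(n\<^sup>2 * p\<^sup>2) * l\<^sup>2 = s\<^sup>2 * n\<^sup>2 * (p * r)\<^sup>2" by (simp add: ls power_mult_distrib)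
    also have "\<dots> = s\<^sup>2 * (n * L)" unfolding pr using n L by (simp add: power2_eq_square)
    finally show ?thesis .
  qed
  have ml: "m - l \<le> l\<^sup>2 / 2 * (1 + \<epsilon>)"
  proof -
    have "l\<^sup>2 / 2 * (1 + l) \<le> l\<^sup>2 / 2 * (1 + \<epsilon>)" using l3 l0 by (intro mult_left_mono) auto
    then show ?thesis using m3 by simp
  qed
  have ml0: "0 \<le> m - l" unfolding m_def using exp_ge_add_one_self[of l] by linarith
  \<comment> \<open>Write m = l + (m - l). The part l reproduces the mean and cancels against the
    centering; the part m - l yields the individual variances, the 1 in v. The common edges in
    \<open>M\<close> supply the x^2 in v below.\<close>
  have "p * (m * (2 * h)) \<le> p * (m * (2 * (p * N + \<epsilon> * D')))"
    using p m0 h unfolding D'_def by (intro mult_left_mono) auto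
  also have "\<dots> = 2 * N * p\<^sup>2 * (m - l) + l * (2 * (N * p\<^sup>2)) + 2 * \<epsilon> * (p * D') * m"
    by (simp add: power2_eq_square algebra_simps)
  also have "\<dots> \<le> n\<^sup>2 * p\<^sup>2 * (l\<^sup>2 / 2 * (1 + \<epsilon>)) + l * (2 * (N * p\<^sup>2)) + 2 * \<epsilon> * (p * D') * (2 * l)"
    using N ml ml0 m1 \<epsilon> p D' by (intro add_mono mult_mono mult_left_mono) auto
  finally have a1: "p * (m * (2 * h)) - l * (2 * (N * p\<^sup>2))
      \<le> s\<^sup>2 * (n * L) / 2 * (1 + \<epsilon>) + 4 * \<epsilon> * (s * (n * L))"
    unfolding lp2[symmetric] lpD[symmetric] by (simp add: algebra_simps)
  have "p * (m\<^sup>2 * M) \<le> p * (m\<^sup>2 * (p * (x\<^sup>2 / 2 + \<epsilon>) * n\<^sup>2))"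
    using p M by (intro mult_left_mono) auto
  also have "\<dots> \<le> p * ((l\<^sup>2 * (1 + \<epsilon>)) * (p * (x\<^sup>2 / 2 + \<epsilon>) * n\<^sup>2))"
    using p msq \<epsilon> by (intro mult_left_mono mult_right_mono) auto
  also have "\<dots> = ((n\<^sup>2 * p\<^sup>2) * l\<^sup>2) * (1 + \<epsilon>) * (x\<^sup>2 / 2 + \<epsilon>)"
    by (simp add: power2_eq_square algebra_simps)
  finally have a2: "p * (m\<^sup>2 * M) \<le> s\<^sup>2 * (n * L) * (1 + \<epsilon>) * (x\<^sup>2 / 2 + \<epsilon>)" unfolding lp2 .
  have ee: "\<epsilon> * \<epsilon> \<le> \<epsilon>" using \<epsilon> mult_left_le[of \<epsilon> \<epsilon>] by simp
  have "v * \<epsilon> \<le> 2 * \<epsilon>" using v \<epsilon> by (intro mult_right_mono) auto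
  then have "(1 + \<epsilon>) * (v + 2 * \<epsilon>) \<le> v + 6 * \<epsilon>"
    using ee by (simp add: algebra_simps)
  then have "s\<^sup>2 / 2 * ((1 + \<epsilon>) * (v + 2 * \<epsilon>)) \<le> s\<^sup>2 / 2 * (v + 6 * \<epsilon>)"
    by (intro mult_left_mono) auto
  also have "\<dots> = s\<^sup>2 * v / 2 + 3 * s\<^sup>2 * \<epsilon>" by (simp add: algebra_simps)
  also have "3 * s\<^sup>2 * \<epsilon> \<le> 3 * 4 * \<epsilon>"
    using s \<epsilon> power_mono[of s 2 2] by (intro mult_right_mono mult_left_mono) auto
  finally have a3: "s\<^sup>2 / 2 * ((1 + \<epsilon>) * (v + 2 * \<epsilon>)) \<le> s\<^sup>2 * v / 2 + 12 * \<epsilon>" by simp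
  \<comment> \<open>The constant 20 is 12 from the variance errors just bounded plus these 8 from
    the slack in the edge count.\<close>
  have a4: "4 * \<epsilon> * s \<le> 8 * \<epsilon>" using s \<epsilon> by simp
  \<comment> \<open>Since s v = 2 beta at the optimal tilt, half of the linear gain 2 beta s is
    spent on the quadratic term and 2 beta^2 / v remains.\<close>
  have "s\<^sup>2 * v / 2 = s * \<beta>" "s * \<beta> = 2 * \<beta>\<^sup>2 / v"
    using v by (simp_all add: s_def power2_eq_square field_simps)
  then have a5: "s\<^sup>2 * v / 2 - 2 * \<beta> * s = - (2 * \<beta>\<^sup>2 / v)"
    by (simp only: mult.assoc mult.commute[of \<beta> s])
  have "p * (m * (2 * h) + m\<^sup>2 * M) - l * (2 * (N * p\<^sup>2 + \<beta> * (p * D')))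
      = (p * (m * (2 * h)) - l * (2 * (N * p\<^sup>2))) + p * (m\<^sup>2 * M) - 2 * \<beta> * (l * (p * D'))"
    by (simp add: algebra_simps)
  also have "\<dots> \<le> (s\<^sup>2 * (n * L) / 2 * (1 + \<epsilon>) + 4 * \<epsilon> * (s * (n * L)))
      + s\<^sup>2 * (n * L) * (1 + \<epsilon>) * (x\<^sup>2 / 2 + \<epsilon>) - 2 * \<beta> * (s * (n * L))"
    using a1 a2 unfolding lpD by linarith
  also have "\<dots> = (n * L) * (s\<^sup>2 / 2 * ((1 + \<epsilon>) * (v + 2 * \<epsilon>)) + 4 * \<epsilon> * s - 2 * \<beta> * s)"
    by (simp add: v_def field_simps)
  also have "\<dots> \<le> (n * L) * (20 * \<epsilon> - 2 * \<beta>\<^sup>2 / v)"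
    using a3 a4 a5 n L by (intro mult_left_mono) auto
  finally show ?thesis unfolding m_def D .
qed

text \<open>Two overlaps above beta D force their sum above 2 beta D, and given H that sum has
  variance about n^2 p^2 (1 + x^2) at full correlation. Before the end of the path the set
  \<open>E\<close> is simply dropped from the covariance, so the estimate is uniform in the number
  of resampled edges; at the end the covariance vanishes and any \<open>x\<close> is
  admissible.\<close>

lemma prob_both_near_optimal:
  assumes n: "1 \<le> n" and p: "0 < p" "p \<le> 1" and \<epsilon>: "0 < \<epsilon>" "\<epsilon> \<le> 1" and x: "0 \<le> x" "x \<le> 1"
    and \<beta>: "0 \<le> \<beta>" "\<beta> \<le> 1" and r: "6 * (sqrt (ln n / n) / p) \<le> \<epsilon>"
    and H: "H \<subseteq> nsets {1..n} 2" "typical_host n p \<epsilon> H"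
    and \<pi>: "\<pi> permutes {1..n}" "\<pi>' permutes {1..n}"
    and E: "nsets {1..n} 2 \<subseteq> E \<or> real (card {i\<in>{1..n}. \<pi> i = \<pi>' i}) \<le> x * n"
  shows "measure_pmf.prob (pair_pmf (erdos_renyi n p) (erdos_renyi n p))
      {(X, Y). \<pi> \<in> S_set \<beta> n p X H \<and> \<pi>' \<in> S_set \<beta> n p (resample E X Y) H}
    \<le> exp (n * ln n * (20 * \<epsilon> - 2 * \<beta>\<^sup>2 / (1 + x\<^sup>2)))"
proof -
  let ?A = "nsets {1..n} 2"
  let ?M = "random_subset ?A p"
  define P where "P = {e \<in> ?A. \<pi> ` e \<in> H}"
  define Q where "Q = {e \<in> ?A. \<pi>' ` e \<in> H}"
  define T where "T = 2 * (real (n choose 2) * p\<^sup>2 + \<beta> * sqrt (real n ^ 3 * p\<^sup>2 * ln n))"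
  define l where "l = 2 * \<beta> * (sqrt (ln n / n) / p) / (1 + x\<^sup>2)"
  have fin: "finite ?A" by (simp add: finite_imp_finite_nsets)
  have L: "0 \<le> ln (real n)" using n by simp
  have l: "0 \<le> l" using \<beta> p L by (simp add: l_def)
  have PQ: "P \<subseteq> ?A" "Q \<subseteq> ?A" "card P = card H" "card Q = card H"
    using card_permuted_edges[OF \<pi>(1) H(1)] card_permuted_edges[OF \<pi>(2) H(1)]
    by (auto simp: P_def Q_def)
  have M: "real (card (P \<inter> Q - E)) \<le> p * (x\<^sup>2 / 2 + \<epsilon>) * (real n)\<^sup>2"
  proof (cases "?A \<subseteq> E")
    case True
    then have "P \<inter> Q - E = {}" using PQ by auto
    then have "card (P \<inter> Q - E) = 0" by (simp only: card.empty)
    then show ?thesis using p \<epsilon> by simp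
  next
    case False
    \<comment> \<open>Agreement points of the two alignments correspond under \<open>\<pi>\<close>
      to fixed points of this permutation, which is the quantity in
      \<open>typical_host\<close>.\<close>
    let ?\<sigma> = "\<pi>' \<circ> inv \<pi>"
    have \<sigma>: "?\<sigma> permutes {1..n}" using \<pi> by (intro permutes_compose permutes_inv)
    have "bij_betw \<pi> {i\<in>{1..n}. \<pi> i = \<pi>' i} {i\<in>{1..n}. ?\<sigma> i = i}"
    proof (rule bij_betw_byWitness[where f' = "inv \<pi>"])
      show "\<forall>a\<in>{i \<in> {1..n}. \<pi> i = \<pi>' i}. inv \<pi> (\<pi> a) = a"
        "\<forall>a\<in>{i \<in> {1..n}. ?\<sigma> i = i}. \<pi> (inv \<pi> a) = a"
        using permutes_inverses[OF \<pi>(1)] by blast+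
      show "\<pi> ` {i \<in> {1..n}. \<pi> i = \<pi>' i} \<subseteq> {i \<in> {1..n}. ?\<sigma> i = i}"
      proof (rule image_subsetI)
        fix i assume i: "i \<in> {i \<in> {1..n}. \<pi> i = \<pi>' i}"
        then have "?\<sigma> (\<pi> i) = \<pi> i" using permutes_inverses(2)[OF \<pi>(1), of i] by (simp only: o_apply) simp
        then show "\<pi> i \<in> {i \<in> {1..n}. ?\<sigma> i = i}" using i permutes_in_image[OF \<pi>(1), of i] by simp
      qed
      show "inv \<pi> ` {i \<in> {1..n}. ?\<sigma> i = i} \<subseteq> {i \<in> {1..n}. \<pi> i = \<pi>' i}"
        using permutes_inverses(1)[OF \<pi>(1)] permutes_in_image[OF permutes_inv[OF \<pi>(1)]]
        by (auto simp del: atLeastAtMost_iff)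
    qed
    then have ceq: "card {i\<in>{1..n}. \<pi> i = \<pi>' i} = card {i\<in>{1..n}. ?\<sigma> i = i}" by (rule bij_betw_same_card)
    have "card (P \<inter> Q - E) \<le> card (P \<inter> Q)"
      using fin PQ by (intro card_mono) (auto intro: finite_subset)
    also have "\<dots> = card {e \<in> ?A. e \<in> H \<and> ?\<sigma> ` e \<in> H}"
      unfolding P_def Q_def by (rule card_common_edges[OF \<pi>])
    finally have "real (card (P \<inter> Q - E)) \<le> real (card {e \<in> ?A. e \<in> H \<and> ?\<sigma> ` e \<in> H})" by simp
    also have "\<dots> \<le> p * ((real (card {i\<in>{1..n}. ?\<sigma> i = i}))\<^sup>2 / 2 + \<epsilon> * (real n)\<^sup>2)"
      using H(2) \<sigma> unfolding typical_host_def by blast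
    also have "\<dots> \<le> p * ((x * n)\<^sup>2 / 2 + \<epsilon> * (real n)\<^sup>2)"
      using E False p x unfolding ceq[symmetric]
      by (intro mult_left_mono add_right_mono divide_right_mono power_mono) auto
    finally show ?thesis by (simp add: power_mult_distrib algebra_simps)
  qed
  have "measure_pmf.prob (pair_pmf (erdos_renyi n p) (erdos_renyi n p))
      {(X, Y). \<pi> \<in> S_set \<beta> n p X H \<and> \<pi>' \<in> S_set \<beta> n p (resample E X Y) H}
    \<le> measure_pmf.prob (pair_pmf ?M ?M)
      {(X, Y). real (card (X \<inter> P)) + real (card (resample E X Y \<inter> Q)) \<ge> T}"
    unfolding erdos_renyi_eq_random_subset
  proof (rule measure_pmf.finite_measure_mono_AE, unfold AE_measure_pmf_iff, intro ballI impI)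
    fix z assume z: "z \<in> set_pmf (pair_pmf ?M ?M)"
      "z \<in> {(X, Y). \<pi> \<in> S_set \<beta> n p X H \<and> \<pi>' \<in> S_set \<beta> n p (resample E X Y) H}"
    obtain X Y where XY: "z = (X, Y)" by (cases z)
    have sub: "X \<subseteq> ?A" "Y \<subseteq> ?A" using z(1) set_pmf_random_subset[of ?A p] by (auto simp: XY)
    then have "resample E X Y \<subseteq> ?A" by (auto simp: resample_def)
    then have "overlap n (resample E X Y) H \<pi>' = card (resample E X Y \<inter> Q)"
      unfolding Q_def by (rule overlap_eq_card[OF \<pi>(2)])
    moreover have "overlap n X H \<pi> = card (X \<inter> P)"
      unfolding P_def by (rule overlap_eq_card[OF \<pi>(1) sub(1)])
    ultimately show "z \<in> {(X, Y). real (card (X \<inter> P)) + real (card (resample E X Y \<inter> Q)) \<ge> T}"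
      using z(2) by (simp add: XY S_set_def centered_overlap_def D_scale_def T_def)
  qed auto
  also have "\<dots> \<le> exp (p * ((exp l - 1) * (card P + card Q) + (exp l - 1)\<^sup>2 * card (P \<inter> Q - E)) - l * T)"
    using p by (intro prob_two_replicas fin PQ l) auto
  also have "\<dots> \<le> exp (n * ln n * (20 * \<epsilon> - 2 * \<beta>\<^sup>2 / (1 + x\<^sup>2)))"
  proof -
    have "p * ((exp l - 1) * (2 * real (card H)) + (exp l - 1)\<^sup>2 * card (P \<inter> Q - E)) - l * T
        \<le> n * ln n * (20 * \<epsilon> - 2 * \<beta>\<^sup>2 / (1 + x\<^sup>2))"
      unfolding T_def
      by (rule two_replica_exponent)
         (use n L p \<epsilon> x \<beta> r H(2) M choose_two_le[of n] in \<open>auto simp: typical_host_def l_def\<close>)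
    then show ?thesis by (simp add: PQ(3,4))
  qed
  finally show ?thesis .
qed

subsection \<open>The resampling path\<close>

text \<open>Each graph on the path, together with H, has the original law, so success and stability
  probabilities transfer to every step. The host comes first in the triple so that it can be
  conditioned on.\<close>

lemma resampled_pair_law:
  "map_pmf (\<lambda>(H, X, Y). (resample E X Y, H))
     (pair_pmf (erdos_renyi n p) (pair_pmf (erdos_renyi n p) (erdos_renyi n p)))
   = erdos_renyi_pair n p"
proof -
  let ?R = "erdos_renyi n p"
  have *: "map_pmf (\<lambda>(X, Y). resample E X Y) (pair_pmf ?R ?R) = ?R"
    unfolding resample_def erdos_renyi_eq_random_subset
    by (rule random_subset_resample) (simp add: finite_imp_finite_nsets)
  have "erdos_renyi_pair n p = map_pmf (\<lambda>(H, X). (X, H)) (pair_pmf ?R ?R)"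
    unfolding erdos_renyi_pair_def by (rule pair_commute_pmf)
  also have "\<dots> = map_pmf (\<lambda>(H, X). (X, H))
      (pair_pmf (map_pmf (\<lambda>H. H) ?R) (map_pmf (\<lambda>(X, Y). resample E X Y) (pair_pmf ?R ?R)))"
    unfolding * by (simp add: pmf.map_ident)
  also have "\<dots> = map_pmf (\<lambda>(H, X, Y). (resample E X Y, H)) (pair_pmf ?R (pair_pmf ?R ?R))"
    unfolding map_pmf_pair_map_pmf by (simp add: case_prod_unfold)
  finally show ?thesis ..
qed

text \<open>A discrete intermediate value argument with only downward jumps controlled: at the last
  index with value at least c, either the path has ended or the next value is below c, so the
  current one is at most c + d.\<close>

lemma last_index_above:
  fixes a :: "nat \<Rightarrow> real"
  assumes "c \<le> a 0" "\<And>k. k < N \<Longrightarrow> a k \<le> a (Suc k) + d"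
  shows "\<exists>k\<le>N. c \<le> a k \<and> (k = N \<or> a k \<le> c + d)"
  using assms(2)
proof (induction N)
  case 0
  then show ?case using assms(1) by auto
next
  case (Suc N)
  then obtain k where k: "k \<le> N" "c \<le> a k" "k = N \<or> a k \<le> c + d" by force
  show ?case
  proof (cases "k = N \<and> c \<le> a (Suc N)")
    case True
    then show ?thesis by (intro exI[of _ "Suc N"]) auto
  next
    case False
    then show ?thesis using k Suc.prems[of N] by (intro exI[of _ k]) auto
  qed
qed

lemma agreements_le_hamming_dist:
  "card {i\<in>{1..n}. \<pi> i = \<sigma> i} \<le> card {i\<in>{1..n}. \<pi> i = \<tau> i} + hamming_dist n \<sigma> \<tau>"
proof -
  have "{i\<in>{1..n}. \<pi> i = \<sigma> i} \<subseteq> {i\<in>{1..n}. \<pi> i = \<tau> i} \<union> {i \<in> {1..n}. \<sigma> i \<noteq> \<tau> i}" by auto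
  then have "card {i\<in>{1..n}. \<pi> i = \<sigma> i} \<le> card ({i\<in>{1..n}. \<pi> i = \<tau> i} \<union> {i \<in> {1..n}. \<sigma> i \<noteq> \<tau> i})"
    by (intro card_mono) auto
  then show ?thesis unfolding hamming_dist_def using card_Un_le order_trans by blast
qed

text \<open>The event inside \<open>almost_stable\<close> for one \<open>n\<close> and perturbations
  of a single edge, named so that it can be evaluated at each graph of the path.\<close>

definition stable_at :: "nat \<Rightarrow> real \<Rightarrow> (nat \<Rightarrow> graph \<Rightarrow> graph \<Rightarrow> nat \<Rightarrow> nat) \<Rightarrow> (graph \<times> graph) set" where
  "stable_at n \<kappa> \<A> = {(G, H). \<forall>G'\<in>simple_graphs n. real (edge_dist G G') \<le> 1 \<longrightarrow>
     real (hamming_dist n (\<A> n G H) (\<A> n G' H)) \<le> \<kappa>}"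

text \<open>
  The case \<open>nsets {1..n} 2 \<subseteq> E\<close> is the end of the path, where the two graphs are independent and
  every agreement above \<open>\<rho> n\<close> is excluded.
\<close>

definition forbidden_pair :: "nat \<Rightarrow> real \<Rightarrow> real \<Rightarrow> real \<Rightarrow> real \<Rightarrow> nat set set \<Rightarrow> (graph \<times> graph \<times> graph) set" where
  "forbidden_pair n p \<beta> \<rho> x E = {(H, X, Y). \<exists>\<pi> \<pi>'. \<pi> permutes {1..n} \<and> \<pi>' permutes {1..n} \<and>
     real (card {i\<in>{1..n}. \<pi> i = \<pi>' i}) \<ge> \<rho> * n \<and>
     (nsets {1..n} 2 \<subseteq> E \<or> real (card {i\<in>{1..n}. \<pi> i = \<pi>' i}) \<le> x * n) \<and>
     \<pi> \<in> S_set \<beta> n p X H \<and> \<pi>' \<in> S_set \<beta> n p (resample E X Y) H}"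

text \<open>Purely deterministic. The agreement of the current output with the initial one starts at
  n, which is at least rho n, and loses at most eta n per step, so it cannot jump over the window.
  The conclusion no longer mentions the algorithm.\<close>

lemma path_hits_forbidden_pair:
  fixes e :: "nat \<Rightarrow> nat set" and p \<beta> \<rho> \<eta> :: real
  assumes e: "bij_betw e {..<N} (nsets {1..n} 2)" and XY: "X \<in> simple_graphs n" "Y \<in> simple_graphs n"
    and succ: "\<And>k. k \<le> N \<Longrightarrow> \<A> n (resample (e ` {..<k}) X Y) H \<in> S_set \<beta> n p (resample (e ` {..<k}) X Y) H"
    and stab: "\<And>k. k < N \<Longrightarrow> (resample (e ` {..<k}) X Y, H) \<in> stable_at n (\<eta> * n) \<A>"
    and \<rho>: "\<rho> \<le> 1"
  shows "\<exists>k\<le>N. (H, X, Y) \<in> forbidden_pair n p \<beta> \<rho> (\<rho> + \<eta>) (e ` {..<k})"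
proof -
  define G where "G k = resample (e ` {..<k}) X Y" for k
  define \<pi> where "\<pi> k = \<A> n (G k) H" for k
  define a where "a k = real (card {i\<in>{1..n}. \<pi> 0 i = \<pi> k i})" for k
  have perm: "\<pi> k permutes {1..n}" if "k \<le> N" for k
    using succ[OF that] by (simp add: \<pi>_def G_def S_set_def)
  have G0: "G 0 = X" by (simp add: G_def resample_def)
  have "\<exists>k\<le>N. \<rho> * n \<le> a k \<and> (k = N \<or> a k \<le> \<rho> * n + \<eta> * n)"
  proof (rule last_index_above)
    show "\<rho> * n \<le> a 0" using mult_right_mono[OF \<rho>, of "real n"] by (simp add: a_def flip: atLeastAtMost_def atLeastAtMost_iff)
    fix k assume k: "k < N"
    have "G (Suc k) \<in> simple_graphs n"
      using XY by (auto simp: G_def resample_def simple_graphs_def)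
    moreover have "edge_dist (G k) (G (Suc k)) \<le> 1"
    proof -
      have "(G k - G (Suc k)) \<union> (G (Suc k) - G k) \<subseteq> {e k}"
        by (auto simp: G_def resample_def lessThan_Suc)
      then have "card ((G k - G (Suc k)) \<union> (G (Suc k) - G k)) \<le> card {e k}" by (intro card_mono) auto
      then show ?thesis by (simp add: edge_dist_def)
    qed
    ultimately have "real (hamming_dist n (\<pi> k) (\<pi> (Suc k))) \<le> \<eta> * n"
      using stab[OF k] by (simp add: stable_at_def \<pi>_def G_def[symmetric])
    then show "a k \<le> a (Suc k) + \<eta> * n"
      using agreements_le_hamming_dist[of n "\<pi> 0" "\<pi> k" "\<pi> (Suc k)"] by (simp add: a_def)
  qed
  then obtain k where k: "k \<le> N" "\<rho> * n \<le> a k" "k = N \<or> a k \<le> \<rho> * n + \<eta> * n" by blast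
  have full: "nsets {1..n} 2 \<subseteq> e ` {..<k}" if "k = N" using that bij_betw_imp_surj_on[OF e] by simp
  have "(H, X, Y) \<in> forbidden_pair n p \<beta> \<rho> (\<rho> + \<eta>) (e ` {..<k})"
    unfolding forbidden_pair_def mem_Collect_eq case_prod_conv
  proof (rule exI[of _ "\<pi> 0"], rule exI[of _ "\<pi> k"], intro conjI)
    show "\<pi> 0 permutes {1..n}" "\<pi> k permutes {1..n}" using perm k(1) by auto
    show "\<rho> * n \<le> real (card {i\<in>{1..n}. \<pi> 0 i = \<pi> k i})" using k(2) by (simp only: a_def)
    show "\<pi> k \<in> S_set \<beta> n p (resample (e ` {..<k}) X Y) H"
      using succ[OF k(1)] by (simp only: \<pi>_def G_def)
    show "\<pi> 0 \<in> S_set \<beta> n p X H"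
      using succ[of 0] by (simp only: \<pi>_def G_def[symmetric] G0 le0)
    show "nsets {1..n} 2 \<subseteq> e ` {..<k} \<or> real (card {i\<in>{1..n}. \<pi> 0 i = \<pi> k i}) \<le> (\<rho> + \<eta>) * n"
      using k(3) full by (auto simp only: a_def distrib_right)
  qed
  then show ?thesis using k(1) by blast
qed

text \<open>For a fixed typical host, a union bound over all permutation pairs with enough
  agreement. The window condition does not depend on X and Y, so it only selects which pairs are
  counted.\<close>

lemma prob_forbidden_pair:
  assumes n: "1 \<le> n" and p: "0 < p" "p \<le> 1" and \<epsilon>: "0 < \<epsilon>" "\<epsilon> \<le> 1" and x: "0 \<le> x" "x \<le> 1"
    and \<beta>: "0 \<le> \<beta>" "\<beta> \<le> 1" and r: "6 * (sqrt (ln n / n) / p) \<le> \<epsilon>" and \<rho>: "0 \<le> \<rho>"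
  shows "measure_pmf.prob (pair_pmf (erdos_renyi n p) (pair_pmf (erdos_renyi n p) (erdos_renyi n p)))
      {(H, z). typical_host n p \<epsilon> H \<and> (H, z) \<in> forbidden_pair n p \<beta> \<rho> x E}
    \<le> real n ^ n * 2 ^ n * real n powr ((1 - \<rho>) * n) * exp (n * ln n * (20 * \<epsilon> - 2 * \<beta>\<^sup>2 / (1 + x\<^sup>2)))"
proof -
  let ?R = "erdos_renyi n p"
  let ?c = "exp (n * ln n * (20 * \<epsilon> - 2 * \<beta>\<^sup>2 / (1 + x\<^sup>2)))"
  define \<P> where "\<P> = {(\<pi>, \<pi>'). \<pi> permutes {1..n} \<and> \<pi>' permutes {1..n} \<and>
    real (card {i\<in>{1..n}. \<pi> i = \<pi>' i}) \<ge> \<rho> * n}"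
  define B where "B H z = {(X, Y). fst z \<in> S_set \<beta> n p X H \<and> snd z \<in> S_set \<beta> n p (resample E X Y) H}"
    for H and z :: "(nat \<Rightarrow> nat) \<times> (nat \<Rightarrow> nat)"
  define \<Q> where "\<Q> = {z\<in>\<P>. nsets {1..n} 2 \<subseteq> E \<or> real (card {i\<in>{1..n}. fst z i = snd z i}) \<le> x * n}"
  have fin\<P>: "finite \<P>"
    by (rule finite_subset[of _ "{\<pi>. \<pi> permutes {1..n}} \<times> {\<pi>. \<pi> permutes {1..n}}"])
       (auto simp: \<P>_def finite_permutations)
  have c\<P>: "real (card \<P>) \<le> real n ^ n * 2 ^ n * real n powr ((1 - \<rho>) * n)"
    unfolding \<P>_def by (rule card_permutation_pairs_le[OF n \<rho>])
  have fin\<Q>: "finite \<Q>" using fin\<P> by (simp add: \<Q>_def)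
  have "card \<Q> \<le> card \<P>" using fin\<P> by (intro card_mono) (auto simp: \<Q>_def)
  then have c\<Q>: "real (card \<Q>) \<le> real n ^ n * 2 ^ n * real n powr ((1 - \<rho>) * n)"
    using c\<P> by linarith
  have "measure_pmf.prob (pair_pmf ?R (pair_pmf ?R ?R))
      {(H, z). H \<in> {H. typical_host n p \<epsilon> H} \<and> (H, z) \<in> forbidden_pair n p \<beta> \<rho> x E} \<le> card \<Q> * ?c"
  proof (rule prob_pair_pmf_le)
    fix H assume H: "H \<in> set_pmf ?R" "H \<in> {H. typical_host n p \<epsilon> H}"
    have HA: "H \<subseteq> nsets {1..n} 2"
      using H(1) set_pmf_random_subset unfolding erdos_renyi_eq_random_subset by blast
    have "{z. (H, z) \<in> forbidden_pair n p \<beta> \<rho> x E} \<subseteq> (\<Union>z\<in>\<Q>. B H z)"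
      by (auto simp: forbidden_pair_def \<Q>_def \<P>_def B_def)
    then have "measure_pmf.prob (pair_pmf ?R ?R) {z. (H, z) \<in> forbidden_pair n p \<beta> \<rho> x E}
      \<le> measure_pmf.prob (pair_pmf ?R ?R) (\<Union>z\<in>\<Q>. B H z)"
      by (intro measure_pmf.finite_measure_mono) auto
    also have "\<dots> \<le> (\<Sum>z\<in>\<Q>. measure_pmf.prob (pair_pmf ?R ?R) (B H z))"
      by (rule measure_pmf.finite_measure_subadditive_finite[OF fin\<Q>]) auto
    also have "\<dots> \<le> (\<Sum>z\<in>\<Q>. ?c)"
    proof (rule sum_mono)
      fix z assume "z \<in> \<Q>"
      then show "measure_pmf.prob (pair_pmf ?R ?R) (B H z) \<le> ?c"
        unfolding B_def using H(2)
        by (intro prob_both_near_optimal n p \<epsilon> x \<beta> r HA) (auto simp: \<Q>_def \<P>_def)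
    qed
    finally show "measure_pmf.prob (pair_pmf ?R ?R) {z. (H, z) \<in> forbidden_pair n p \<beta> \<rho> x E} \<le> card \<Q> * ?c"
      by simp
  qed simp
  also have "\<dots> \<le> real n ^ n * 2 ^ n * real n powr ((1 - \<rho>) * n) * ?c"
    using c\<Q> by (intro mult_right_mono) auto
  finally show ?thesis by simp
qed

text \<open>If the success bound failed, the four bad events (an unsuccessful step, an unstable
  step, a forbidden pair, an atypical host) would cover the probability space, yet have total mass
  at most 1/2 + 3/8.\<close>

lemma success_bound:
  fixes p \<epsilon> \<rho> \<eta> \<beta> :: real
  assumes n: "2 \<le> n" and p: "0 < p" "p \<le> 1" and \<epsilon>: "0 < \<epsilon>" "\<epsilon> \<le> 1"
    and \<rho>: "0 \<le> \<rho>" "0 \<le> \<eta>" "\<rho> + \<eta> \<le> 1" and \<beta>: "0 \<le> \<beta>" "\<beta> \<le> 1"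
    and r: "6 * (sqrt (ln n / n) / p) \<le> \<epsilon>"
    and host: "measure_pmf.prob (erdos_renyi n p) {H. \<not> typical_host n p \<epsilon> H} \<le> 1/8"
    and fm: "(real n)\<^sup>2 * (real n ^ n * 2 ^ n * real n powr ((1 - \<rho>) * n)
      * exp (n * ln n * (20 * \<epsilon> - 2 * \<beta>\<^sup>2 / (1 + (\<rho> + \<eta>)\<^sup>2)))) \<le> 1/8"
    and stab: "1 - measure_pmf.prob (erdos_renyi_pair n p) (stable_at n (\<eta> * n) \<A>) \<le> 1/8 / (real n)\<^sup>2"
  shows "measure_pmf.prob (erdos_renyi_pair n p) {(G, H). \<A> n G H \<in> S_set \<beta> n p G H} \<le> 1 - 1 / (real n)\<^sup>2"
proof (rule ccontr)
  assume neg: "\<not> ?thesis"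
  let ?R = "erdos_renyi n p"
  define \<Omega> where "\<Omega> = pair_pmf ?R (pair_pmf ?R ?R)"
  define N where "N = n choose 2"
  define c where "c = real n ^ n * 2 ^ n * real n powr ((1 - \<rho>) * n)
      * exp (n * ln n * (20 * \<epsilon> - 2 * \<beta>\<^sup>2 / (1 + (\<rho> + \<eta>)\<^sup>2)))"
  let ?A = "nsets {1..n} 2"
  have "finite ?A" by (simp add: finite_imp_finite_nsets)
  then obtain e where e: "bij_betw e {..<N} ?A"
    using ex_bij_betw_nat_finite[of ?A] by (auto simp: N_def atLeast0LessThan)
  define E where "E k = e ` {..<k}" for k
  define \<phi> where "\<phi> k = (\<lambda>(H, X, Y). (resample (E k) X Y, H :: graph))" for k
  define Succ where "Succ = {(G, H). \<A> n G H \<in> S_set \<beta> n p G H}"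
  define Stab where "Stab = stable_at n (\<eta> * n) \<A>"
  define F where "F k = {(H, z). typical_host n p \<epsilon> H \<and> (H, z) \<in> forbidden_pair n p \<beta> \<rho> (\<rho> + \<eta>) (E k)}" for k
  \<comment> \<open>The host is never resampled, so its atypicality is paid for once instead of once
    per step; this is why typicality is also built into \<open>F\<close>.\<close>
  define T where "T = {\<omega> :: graph \<times> graph \<times> graph. \<not> typical_host n p \<epsilon> (fst \<omega>)}"
  define U1 where "U1 = (\<Union>k\<in>{..N}. \<phi> k -` (- Succ))"
  define U2 where "U2 = (\<Union>k\<in>{..<N}. \<phi> k -` (- Stab))"
  define U3 where "U3 = (\<Union>k\<in>{..N}. F k)"
  have law: "map_pmf (\<phi> k) \<Omega> = erdos_renyi_pair n p" for k
    unfolding \<phi>_def \<Omega>_def by (rule resampled_pair_law)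
  have pull: "measure_pmf.prob \<Omega> (\<phi> k -` (- B)) = 1 - measure_pmf.prob (erdos_renyi_pair n p) B" for k B
  proof -
    have "measure_pmf.prob \<Omega> (\<phi> k -` (- B)) = measure_pmf.prob (erdos_renyi_pair n p) (- B)"
      unfolding law[of k, symmetric] by simp
    then show ?thesis by (simp add: measure_pmf.prob_compl[of B "erdos_renyi_pair n p", simplified] Compl_eq_Diff_UNIV)
  qed
  have N2: "real N = ((real n)\<^sup>2 - real n) / 2"
  proof -
    have "even (n * (n - 1))" by (cases n) auto
    then have "real N = real (n * (n - 1)) / 2" unfolding N_def choose_two by (simp add: real_of_nat_div)
    then show ?thesis using n by (simp add: of_nat_diff power2_eq_square algebra_simps)
  qed
  \<comment> \<open>A path of N steps visits N + 1 graphs; \<open>2 \<le> n\<close> is exactly what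
    absorbs the additional one.\<close>
  have N1: "real N + 1 \<le> (real n)\<^sup>2 / 2" unfolding N2 using n by (simp add: field_simps)
  have n0: "0 < (real n)\<^sup>2" using n by simp
  then have N3: "real N \<le> (real n)\<^sup>2" "real N + 1 \<le> (real n)\<^sup>2" using N1 by linarith+
  have "measure_pmf.prob \<Omega> U1 \<le> (\<Sum>k\<le>N. measure_pmf.prob \<Omega> (\<phi> k -` (- Succ)))"
    unfolding U1_def by (rule measure_pmf.finite_measure_subadditive_finite) auto
  also have "\<dots> = (real N + 1) * (1 - measure_pmf.prob (erdos_renyi_pair n p) Succ)"
    unfolding pull by simp
  also have "\<dots> \<le> (real n)\<^sup>2 / 2 * (1 / (real n)\<^sup>2)"
    using N1 neg by (intro mult_mono) (auto simp: Succ_def)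
  finally have p1: "measure_pmf.prob \<Omega> U1 \<le> 1/2" using n0 by simp
  have "measure_pmf.prob \<Omega> U2 \<le> (\<Sum>k<N. measure_pmf.prob \<Omega> (\<phi> k -` (- Stab)))"
    unfolding U2_def by (rule measure_pmf.finite_measure_subadditive_finite) auto
  also have "\<dots> = real N * (1 - measure_pmf.prob (erdos_renyi_pair n p) Stab)"
    unfolding pull by simp
  also have "\<dots> \<le> (real n)\<^sup>2 * (1/8 / (real n)\<^sup>2)"
    using stab by (intro mult_mono N3(1)) (auto simp: Stab_def)
  finally have p2: "measure_pmf.prob \<Omega> U2 \<le> 1/8" using n0 by simp
  have "measure_pmf.prob \<Omega> U3 \<le> (\<Sum>k\<le>N. measure_pmf.prob \<Omega> (F k))"
    unfolding U3_def by (rule measure_pmf.finite_measure_subadditive_finite) auto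
  also have "\<dots> \<le> (\<Sum>k\<le>N. c)"
    unfolding F_def \<Omega>_def c_def
    by (intro sum_mono prob_forbidden_pair p \<epsilon> \<beta> r \<rho>) (use n \<rho> in auto)
  also have "\<dots> = (real N + 1) * c" by simp
  also have "\<dots> \<le> (real n)\<^sup>2 * c" by (intro mult_right_mono N3(2)) (auto simp: c_def)
  finally have p3: "measure_pmf.prob \<Omega> U3 \<le> 1/8" using fm by (simp add: c_def)
  have "measure_pmf.prob \<Omega> T = measure_pmf.prob (map_pmf fst \<Omega>) {H. \<not> typical_host n p \<epsilon> H}"
    by (simp add: T_def vimage_def)
  also have "map_pmf fst \<Omega> = ?R" unfolding \<Omega>_def by (rule map_fst_pair_pmf)
  finally have p4: "measure_pmf.prob \<Omega> T \<le> 1/8" using host by simp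
  have "measure_pmf.prob \<Omega> UNIV \<le> measure_pmf.prob \<Omega> ((U1 \<union> U2) \<union> (U3 \<union> T))"
  proof (rule measure_pmf.finite_measure_mono_AE, unfold AE_measure_pmf_iff, intro ballI impI)
    fix \<omega> assume \<omega>: "\<omega> \<in> set_pmf \<Omega>"
    obtain H X Y where HXY: "\<omega> = (H, X, Y)" by (cases \<omega>)
    have XY: "X \<in> simple_graphs n" "Y \<in> simple_graphs n"
      using \<omega> set_pmf_random_subset[of ?A p]
      by (auto simp: HXY \<Omega>_def erdos_renyi_eq_random_subset simple_graphs_def)
    show "\<omega> \<in> (U1 \<union> U2) \<union> (U3 \<union> T)"
    proof (rule ccontr)
      assume out: "\<omega> \<notin> (U1 \<union> U2) \<union> (U3 \<union> T)"
      have "\<exists>k\<le>N. (H, X, Y) \<in> forbidden_pair n p \<beta> \<rho> (\<rho> + \<eta>) (e ` {..<k})"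
      proof (rule path_hits_forbidden_pair[OF e XY])
        show "\<A> n (resample (e ` {..<k}) X Y) H \<in> S_set \<beta> n p (resample (e ` {..<k}) X Y) H" if "k \<le> N" for k
          using out that by (auto simp: U1_def HXY \<phi>_def Succ_def E_def)
        show "(resample (e ` {..<k}) X Y, H) \<in> stable_at n (\<eta> * n) \<A>" if "k < N" for k
          using out that by (auto simp: U2_def HXY \<phi>_def Stab_def E_def)
      qed (use \<rho> in simp)
      then show False using out by (auto simp: U3_def T_def F_def E_def HXY)
    qed
  qed auto
  also have "\<dots> \<le> measure_pmf.prob \<Omega> (U1 \<union> U2) + measure_pmf.prob \<Omega> (U3 \<union> T)"
    by (rule measure_Un_le) auto
  also have "\<dots> \<le> (measure_pmf.prob \<Omega> U1 + measure_pmf.prob \<Omega> U2) + (measure_pmf.prob \<Omega> U3 + measure_pmf.prob \<Omega> T)"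
    by (intro add_mono measure_Un_le) auto
  finally show False using p1 p2 p3 p4 by simp
qed

section \<open>Asymptotics and conclusion\<close>

text \<open>In exponential form the coefficient of n ln n is a - c < 0, which dominates n ln 2 and 2
  ln n.\<close>

lemma first_moment_tendsto_0:
  fixes a c :: real
  assumes "a - c < 0"
  shows "((\<lambda>n. (real n)\<^sup>2 * (real n ^ n * 2 ^ n * real n powr ((a - 1) * n) * exp (n * ln n * (- c)))) \<longlongrightarrow> 0) sequentially"
proof -
  define d where "d = c - a"
  have d: "d > 0" using assms by (simp add: d_def)
  have "((\<lambda>n. (real n)\<^sup>2 * exp (real n * ln 2 - d * (n * ln n))) \<longlongrightarrow> 0) sequentially"
    using d by real_asymp
  moreover have "\<forall>\<^sub>F n in sequentially. (real n)\<^sup>2 * exp (real n * ln 2 - d * (n * ln n))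
    = (real n)\<^sup>2 * (real n ^ n * 2 ^ n * real n powr ((a - 1) * n) * exp (n * ln n * (- c)))"
    using eventually_gt_at_top[of 0]
  proof eventually_elim
    case (elim n)
    have "real n ^ n = exp (n * ln n)" using elim by (simp add: exp_of_nat_mult)
    moreover have "(2::real) ^ n = exp (n * ln 2)" by (simp add: exp_of_nat_mult)
    moreover have "real n powr ((a - 1) * n) = exp ((a - 1) * n * ln n)" using elim by (simp add: powr_def)
    ultimately show ?case by (simp add: d_def exp_add[symmetric] algebra_simps)
  qed
  ultimately show ?thesis by (rule Lim_transform_eventually)
qed

text \<open>Eventually p >= sqrt(ln n / n), so n^2 p is at least n^(3/2) sqrt(ln n) and beats the n
  ln n from the union over permutations. Replacing p by this explicit lower bound leaves a function
  of n alone for \<open>real_asymp\<close>.\<close>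

lemma not_typical_host_tendsto_0:
  assumes p: "\<And>n. 0 \<le> p n \<and> p n \<le> 1"
    and p_lower: "(\<lambda>n. sqrt (ln (real n) / real n)) \<in> o(p)" and p_upper: "p \<in> o(\<lambda>n. 1)"
    and \<epsilon>: "0 < \<epsilon>" "\<epsilon> \<le> 1"
  shows "((\<lambda>n. measure_pmf.prob (erdos_renyi n (p n)) {H. \<not> typical_host n (p n) \<epsilon> H}) \<longlongrightarrow> 0) sequentially"
proof -
  define d where "d = \<epsilon>\<^sup>2 / 18"
  have d: "d > 0" using \<epsilon> by (simp add: d_def)
  have "\<forall>\<^sub>F n in sequentially. norm (p n) \<le> 2 / exp (18 / \<epsilon>) * norm (1::real)"
    by (rule landau_o.smallD[OF p_upper]) simp
  then have up: "\<forall>\<^sub>F n in sequentially. exp (18 / \<epsilon>) * p n \<le> 2"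
    by eventually_elim (use p in \<open>simp add: field_simps abs_le_iff\<close>)
  have "\<forall>\<^sub>F n in sequentially. norm (sqrt (ln (real n) / real n)) \<le> 1 * norm (p n)"
    by (rule landau_o.smallD[OF p_lower]) simp
  then have low: "\<forall>\<^sub>F n in sequentially. sqrt (ln (real n) / real n) \<le> p n"
    by eventually_elim (use p in \<open>simp add: abs_le_iff\<close>)
  have large: "\<forall>\<^sub>F n in sequentially. 3 / \<epsilon> \<le> real n" by real_asymp
  show ?thesis
  proof (rule tendsto_sandwich[OF _ _ tendsto_const])
    show "\<forall>\<^sub>F n in sequentially. 0 \<le> measure_pmf.prob (erdos_renyi n (p n)) {H. \<not> typical_host n (p n) \<epsilon> H}"
      by simp
    show "\<forall>\<^sub>F n in sequentially. measure_pmf.prob (erdos_renyi n (p n)) {H. \<not> typical_host n (p n) \<epsilon> H}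
      \<le> exp (n - \<epsilon> * (n * sqrt (ln n)))
        + exp (n * ln n) * (exp (- d * ((real n)\<^sup>2 * sqrt (ln n / n))) + exp (- ((real n)\<^sup>2 * sqrt (ln n / n))))"
      using up low large eventually_gt_at_top[of 0]
    proof eventually_elim
      case (elim n)
      have nn: "real n ^ n = exp (n * ln n)" using elim(4) by (simp add: exp_of_nat_mult)
      have q: "(real n)\<^sup>2 * sqrt (ln n / n) \<le> (real n)\<^sup>2 * p n" using elim(2) by (intro mult_left_mono) auto
      have "measure_pmf.prob (erdos_renyi n (p n)) {H. \<not> typical_host n (p n) \<epsilon> H}
        \<le> exp (n - \<epsilon> * (n * sqrt (ln n)))
          + real n ^ n * (exp (- (real n)\<^sup>2 * p n * \<epsilon>\<^sup>2 / 18) + exp (- (real n)\<^sup>2 * p n))"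
        by (rule prob_not_typical_host) (use p \<epsilon> elim in auto)
      also have "exp (- (real n)\<^sup>2 * p n * \<epsilon>\<^sup>2 / 18) \<le> exp (- d * ((real n)\<^sup>2 * sqrt (ln n / n)))"
        using mult_left_mono[OF q, of d] d by (simp add: d_def algebra_simps)
      also have "exp (- (real n)\<^sup>2 * p n) \<le> exp (- ((real n)\<^sup>2 * sqrt (ln n / n)))"
        using q by simp
      finally show ?case unfolding nn by (simp add: add_mono mult_left_mono)
    qed
    have "((\<lambda>n. exp (real n - \<epsilon> * (n * sqrt (ln n)))) \<longlongrightarrow> 0) sequentially"
      using \<epsilon>(1) by real_asymp
    moreover have "((\<lambda>n. exp (real n * ln n - d * ((real n)\<^sup>2 * sqrt (ln n / n)))) \<longlongrightarrow> 0) sequentially"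
      using d by real_asymp
    moreover have "((\<lambda>n. exp (real n * ln n - (real n)\<^sup>2 * sqrt (ln n / n))) \<longlongrightarrow> 0) sequentially"
      by real_asymp
    ultimately have "((\<lambda>n. exp (real n - \<epsilon> * (n * sqrt (ln n)))
        + (exp (real n * ln n - d * ((real n)\<^sup>2 * sqrt (ln n / n)))
          + exp (real n * ln n - (real n)\<^sup>2 * sqrt (ln n / n)))) \<longlongrightarrow> 0) sequentially"
      by (intro tendsto_add_zero)
    then show "((\<lambda>n. exp (n - \<epsilon> * (n * sqrt (ln n)))
        + exp (n * ln n) * (exp (- d * ((real n)\<^sup>2 * sqrt (ln n / n))) + exp (- ((real n)\<^sup>2 * sqrt (ln n / n))))) \<longlongrightarrow> 0)
        sequentially"
      by (simp add: distrib_left exp_diff exp_minus divide_inverse)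
  qed
qed

theorem theorem4p1:
  fixes p :: "nat \<Rightarrow> real" and \<rho>\<^sub>0 \<beta>\<^sub>0 \<eta> :: real
    and \<A> :: "nat \<Rightarrow> graph \<Rightarrow> graph \<Rightarrow> nat \<Rightarrow> nat"
  assumes p_prob: "\<And>n. 0 \<le> p n \<and> p n \<le> 1"
    and p_lower: "(\<lambda>n. sqrt (ln (real n) / real n)) \<in> o(p)"
    and p_upper: "p \<in> o(\<lambda>n. 1)"
    and rho: "\<rho>\<^sub>0 = 1 / 3"
    and beta: "sqrt (25 / 27) < \<beta>\<^sub>0" "\<beta>\<^sub>0 < 1"
    and eta: "\<eta> > 0" "2 - \<rho>\<^sub>0 + \<eta> - 2 * \<beta>\<^sub>0\<^sup>2 / (1 + (\<rho>\<^sub>0 + \<eta>)\<^sup>2) < 0"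
    and alg: "alignment_algorithm \<A>"
    and stable: "almost_stable p (\<lambda>n. 1) (\<lambda>n. \<eta> * real n) \<A>"
  shows "\<forall>\<^sub>F n in sequentially.
    measure_pmf.prob (erdos_renyi_pair n (p n)) {(G, H). \<A> n G H \<in> S_set \<beta>\<^sub>0 n (p n) G H}
      \<le> 1 - 1 / (real n)\<^sup>2"
proof -
  have "0 \<le> sqrt (25 / 27 :: real)" by simp
  then have \<beta>: "0 \<le> \<beta>\<^sub>0" "\<beta>\<^sub>0 \<le> 1" using beta by linarith+
  \<comment> \<open>Needed for \<open>\<rho>\<^sub>0 + \<eta> \<le> 1\<close>, so that the upper end
    of the agreement window is an admissible \<open>x\<close>.\<close>
  have \<eta>: "\<eta> < 1 / 3"
  proof -
    have "2 * \<beta>\<^sub>0\<^sup>2 / (1 + (\<rho>\<^sub>0 + \<eta>)\<^sup>2) \<le> 2 * \<beta>\<^sub>0\<^sup>2 / 1"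
      by (rule divide_left_mono) (auto intro: add_pos_nonneg)
    also have "\<dots> \<le> 2" using \<beta> by (simp add: power_le_one)
    finally show ?thesis using eta(2) rho by linarith
  qed
  \<comment> \<open>The hypothesis puts the exponent below -eta; with this choice the total error
    \<open>20 * \<epsilon>\<close> uses up half of that margin.\<close>
  define \<epsilon> where "\<epsilon> = \<eta> / 40"
  have \<epsilon>: "0 < \<epsilon>" "\<epsilon> \<le> 1" "20 * \<epsilon> = \<eta> / 2" using eta(1) \<eta> by (auto simp: \<epsilon>_def)
  define c where "c = 2 * \<beta>\<^sub>0\<^sup>2 / (1 + (\<rho>\<^sub>0 + \<eta>)\<^sup>2) - 20 * \<epsilon>"
  have "(2 - \<rho>\<^sub>0) - c < 0" using eta unfolding c_def \<epsilon>(3) by linarith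
  then have "((\<lambda>n. (real n)\<^sup>2 * (real n ^ n * 2 ^ n * real n powr ((2 - \<rho>\<^sub>0 - 1) * n) * exp (n * ln n * (- c)))) \<longlongrightarrow> 0) sequentially"
    by (rule first_moment_tendsto_0)
  then have fm: "\<forall>\<^sub>F n in sequentially. (real n)\<^sup>2 * (real n ^ n * 2 ^ n * real n powr ((2 - \<rho>\<^sub>0 - 1) * n) * exp (n * ln n * (- c))) < 1/8"
    by (rule order_tendstoD(2)) simp
  have host: "\<forall>\<^sub>F n in sequentially. measure_pmf.prob (erdos_renyi n (p n)) {H. \<not> typical_host n (p n) \<epsilon> H} < 1/8"
    by (rule order_tendstoD(2)[OF not_typical_host_tendsto_0[OF p_prob p_lower p_upper \<epsilon>(1,2)]]) simp
  have stab: "\<forall>\<^sub>F n in sequentially. norm (1 - measure_pmf.prob (erdos_renyi_pair n (p n)) (stable_at n (\<eta> * n) \<A>))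
      \<le> 1/8 * norm (1 / (real n)\<^sup>2)"
    using landau_o.smallD[OF stable[unfolded almost_stable_def], of "1/8"] by (simp add: stable_at_def)
  have low: "\<forall>\<^sub>F n in sequentially. norm (sqrt (ln (real n) / real n)) \<le> \<epsilon> / 6 * norm (p n)"
    by (rule landau_o.smallD[OF p_lower]) (use \<epsilon> in simp)
  show ?thesis
    using fm host stab low eventually_ge_at_top[of 2]
  proof eventually_elim
    case (elim n)
    have "0 < sqrt (ln (real n) / real n)" using elim(5) by simp
    moreover have low': "sqrt (ln (real n) / real n) \<le> \<epsilon> / 6 * p n" using elim(4) p_prob[of n] by simp
    ultimately have "0 < \<epsilon> / 6 * p n" by linarith
    then have p0: "0 < p n" using \<epsilon> by (simp add: zero_less_mult_iff)
    show ?case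
    proof (rule success_bound[where \<epsilon> = \<epsilon> and \<rho> = \<rho>\<^sub>0 and \<eta> = \<eta>])
      show "6 * (sqrt (ln n / n) / p n) \<le> \<epsilon>" using low' p0 by (simp add: field_simps)
      show "(real n)\<^sup>2 * (real n ^ n * 2 ^ n * real n powr ((1 - \<rho>\<^sub>0) * n)
          * exp (n * ln n * (20 * \<epsilon> - 2 * \<beta>\<^sub>0\<^sup>2 / (1 + (\<rho>\<^sub>0 + \<eta>)\<^sup>2)))) \<le> 1/8"
        using elim(1) by (simp add: c_def)
      show "1 - measure_pmf.prob (erdos_renyi_pair n (p n)) (stable_at n (\<eta> * n) \<A>) \<le> 1/8 / (real n)\<^sup>2"
        using elim(3) by simp
    qed (use elim p0 p_prob[of n] \<epsilon> \<beta> rho eta(1) \<eta> in auto)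
  qed
qed

end
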